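(* Let $\mathcal{A}$ be a unital $C^*$-subalgebra of $M_d$ and let $\mathbf{E}_{\mathcal{A}}$ be the unique trace-preserving conditional expectation of $M_d$ onto $\mathcal{A}$. Fix any norm $\|\cdot\|$ on the space of linear maps on $M_d$. Then there exists $r_{\mathcal{A}}>0$ such that every $\Phi\in\mathcal{F}(\mathcal{A})$ with $\|\Phi-\mathbf{E}_{\mathcal{A}}\|\le r_{\mathcal{A}}$ is a mixed unitary channel.
   Context: $M_d$ denotes the complex $d\times d$ matrices, $\mathrm{Ad}_V(X)=V^*XV$. A unital quantum channel on $M_d$ is a completely positive, unital ($\Phi(I)=I$), trace-preserving linear map $M_d\to M_d$. It is mixed unitary if $\Phi=\sum_{j=1}^\ell\lambda_j\mathrm{Ad}_{U_j}$ with unitaries $U_j$, $\lambda_j\ge0$, $\sum_j\lambda_j=1$. A conditional expectation onto a unital $C^*$-subalgebra $\mathcal{A}\subseteq M_d$ is a completely positive map $\mathbf{E}:M_d\to M_d$ with range $\mathcal{A}$ and $\mathbf{E}(A)=A$ for all $A\in\mathcal{A}$; the unique trace-preserving one, $\mathbf{E}_{\mathcal{A}}$, is the orthogonal projection of $M_d$ onto $\mathcal{A}$ for the Hilbert–Schmidt inner product $\mathrm{tr}(X^*Y)$. $\mathcal{F}(\mathcal{A})$ denotes the set of unital quantum channels $\Phi$ on $M_d$ with $\Phi(A)=A$ for all $A\in\mathcal{A}$. *)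

theory Defs
  imports "HOL-Analysis.Analysis"
begin

type_synonym 'n cmat = "complex^'n^'n"

definition cadj :: "'n::finite cmat \<Rightarrow> 'n cmat" where
  "cadj A = (\<chi> i j. cnj (A $ j $ i))"

definition csmult :: "complex \<Rightarrow> 'n::finite cmat \<Rightarrow> 'n cmat" where
  "csmult c A = (\<chi> i j. c * A $ i $ j)"

definition unitary :: "'n::finite cmat \<Rightarrow> bool" where
  "unitary U \<longleftrightarrow> cadj U ** U = mat 1 \<and> U ** cadj U = mat 1"

definition Ad :: "'n::finite cmat \<Rightarrow> 'n cmat \<Rightarrow> 'n cmat" where
  "Ad V X = cadj V ** X ** V"

definition clinear_map :: "('n::finite cmat \<Rightarrow> 'n cmat) \<Rightarrow> bool" where
  "clinear_map F \<longleftrightarrow> (\<forall>A B. F (A + B) = F A + F B) \<and> (\<forall>c A. F (csmult c A) = csmult c (F A))"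

text \<open>Positivity of a k x k block matrix (A i j) with blocks in M_d, i.e. of an element of
  M_k(M_d): for every vector (x_0,...,x_{k-1}) in (C^d)^k, sum_{i,j} x_i^* A_ij x_j is a real number >= 0.\<close>
definition block_psd :: "nat \<Rightarrow> (nat \<Rightarrow> nat \<Rightarrow> 'n::finite cmat) \<Rightarrow> bool" where
  "block_psd k A \<longleftrightarrow>
     (\<forall>x :: nat \<Rightarrow> complex^'n. \<exists>r::real. r \<ge> 0 \<and>
        (\<Sum>i<k. \<Sum>j<k. \<Sum>a\<in>UNIV. cnj (x i $ a) * ((A i j *v x j) $ a)) = complex_of_real r)"

definition completely_positive :: "('n::finite cmat \<Rightarrow> 'n cmat) \<Rightarrow> bool" where
  "completely_positive F \<longleftrightarrow> clinear_map F \<and>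
     (\<forall>k (A :: nat \<Rightarrow> nat \<Rightarrow> 'n cmat). block_psd k A \<longrightarrow> block_psd k (\<lambda>i j. F (A i j)))"

definition unital_channel :: "('n::finite cmat \<Rightarrow> 'n cmat) \<Rightarrow> bool" where
  "unital_channel F \<longleftrightarrow> completely_positive F \<and> F (mat 1) = mat 1 \<and> (\<forall>X. trace (F X) = trace X)"

definition mixed_unitary :: "('n::finite cmat \<Rightarrow> 'n cmat) \<Rightarrow> bool" where
  "mixed_unitary F \<longleftrightarrow> (\<exists>(l::nat) (lam :: nat \<Rightarrow> real) (U :: nat \<Rightarrow> 'n cmat).
     (\<forall>j<l. lam j \<ge> 0 \<and> unitary (U j)) \<and> (\<Sum>j<l. lam j) = 1 \<and>
     (\<forall>X. F X = (\<Sum>j<l. csmult (complex_of_real (lam j)) (Ad (U j) X))))"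

definition unital_cstar_subalgebra :: "'n::finite cmat set \<Rightarrow> bool" where
  "unital_cstar_subalgebra S \<longleftrightarrow> mat 1 \<in> S \<and>
     (\<forall>A\<in>S. \<forall>B\<in>S. A + B \<in> S \<and> A ** B \<in> S) \<and>
     (\<forall>c. \<forall>A\<in>S. csmult c A \<in> S) \<and> (\<forall>A\<in>S. cadj A \<in> S)"

definition cond_expectation :: "'n::finite cmat set \<Rightarrow> ('n cmat \<Rightarrow> 'n cmat) \<Rightarrow> bool" where
  "cond_expectation S E \<longleftrightarrow> completely_positive E \<and> range E = S \<and> (\<forall>A\<in>S. E A = A)"

definition fixing_channels :: "'n::finite cmat set \<Rightarrow> ('n cmat \<Rightarrow> 'n cmat) set" where
  "fixing_channels S = {F. unital_channel F \<and> (\<forall>A\<in>S. F A = A)}"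

definition is_map_norm :: "(('n::finite cmat \<Rightarrow> 'n cmat) \<Rightarrow> real) \<Rightarrow> bool" where
  "is_map_norm N \<longleftrightarrow>
     (\<forall>F. clinear_map F \<longrightarrow> N F \<ge> 0 \<and> (N F = 0 \<longleftrightarrow> F = (\<lambda>_. 0))) \<and>
     (\<forall>F G. clinear_map F \<longrightarrow> clinear_map G \<longrightarrow> N (\<lambda>X. F X + G X) \<le> N F + N G) \<and>
     (\<forall>F c. clinear_map F \<longrightarrow> N (\<lambda>X. csmult c (F X)) = cmod c * N F)"

end

theory Submission
  imports Defs
begin

text \<open>
  Let \<open>B\<close> be the commutant of \<open>S\<close>. The Kraus operators of a channel fixing \<open>S\<close> lie in \<open>B\<close>, so the
  channels \<open>Ad U\<close> with \<open>U\<close> a unitary of \<open>B\<close> are the natural building blocks; let \<open>K\<close> be their convex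
  hull. It suffices that \<open>E\<close> is a relative interior point of \<open>K\<close> and that every channel fixing \<open>S\<close>
  lies in the affine hull of \<open>K\<close>.

  For the first claim, the unitary group of \<open>B\<close> acts on \<open>K\<close> by isometries, and the point of least norm
  in the convex hull of the orbit of a relative interior point is an invariant relative interior
  point. An invariant point of \<open>K\<close> has its range in \<open>S\<close> (a bicommutant argument in which \<open>E\<close> replaces the
  double commutant theorem) and hence equals \<open>E\<close>.

  For the second claim, a functional that is constant on \<open>K\<close> is a sesquilinear form \<open>h\<close> on \<open>B\<close> with
  \<open>h U U\<close> constant on unitaries, and one has to see that \<open>\<Sum> h V\<^sub>k V\<^sub>k\<close> takes the same value when
  \<open>\<Sum> V\<^sub>k\<^sup>* V\<^sub>k = \<Sum> V\<^sub>k V\<^sub>k\<^sup>* = 1\<close>. Testing on unitaries with three spectral projections shows that, up to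
  the symmetric term \<open>X\<^sup>* Y + Y X\<^sup>*\<close>, the form is \<open>tr (X\<^sup>* D(Y))\<close> with a Jordan derivation \<open>D\<close> of \<open>B\<close>; a
  Casimir element of \<open>B\<close> shows that \<open>D\<close> is inner, and commutators contribute nothing to the sum.
\<close>

section \<open>Matrix algebra\<close>

lemma mmul_add_left: "(A + B) ** C = A ** C + B ** (C :: complex^'n^'m)"
  by (simp add: matrix_matrix_mult_def vec_eq_iff distrib_right sum.distrib)

lemma mmul_diff_left: "(A - B) ** C = A ** C - B ** (C :: complex^'n^'m)"
  by (simp add: matrix_matrix_mult_def vec_eq_iff left_diff_distrib sum_subtractf)

lemma mmul_diff_right: "A ** (B - C) = A ** B - A ** (C :: complex^'n^'m)"
  by (simp add: matrix_matrix_mult_def vec_eq_iff right_diff_distrib sum_subtractf)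

lemma mmul_zero_left [simp]: "0 ** A = (0 :: complex^'n^'m)"
  by (simp add: matrix_matrix_mult_def vec_eq_iff)

lemma mmul_sum_left: "(\<Sum>i\<in>I. f i) ** A = (\<Sum>i\<in>I. f i ** (A :: complex^'n^'m))"
  by (induction I rule: infinite_finite_induct) (auto simp: mmul_add_left)

lemma mmul_sum_right: "A ** (\<Sum>i\<in>I. f i) = (\<Sum>i\<in>I. A ** (f i :: complex^'n^'m))"
  by (induction I rule: infinite_finite_induct) (auto simp: matrix_add_ldistrib)

lemma mmul_scaleR_left [simp]: "(c *\<^sub>R A) ** B = c *\<^sub>R (A ** (B :: complex^'n^'m))"
  by (simp add: matrix_matrix_mult_def vec_eq_iff scaleR_sum_right)

lemma mmul_scaleR_right [simp]: "A ** (c *\<^sub>R B) = c *\<^sub>R (A ** (B :: complex^'n^'m))"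
  by (simp add: matrix_matrix_mult_def vec_eq_iff scaleR_sum_right)

lemma csmult_mmul_left [simp]: "csmult c A ** B = csmult c (A ** B)"
  by (simp add: matrix_matrix_mult_def csmult_def vec_eq_iff sum_distrib_left mult.assoc)

lemma csmult_mmul_right [simp]: "A ** csmult c B = csmult c (A ** B)"
  by (simp add: matrix_matrix_mult_def csmult_def vec_eq_iff sum_distrib_left mult.left_commute)

lemmas mmul_distribs = mmul_add_left matrix_add_ldistrib mmul_diff_left mmul_diff_right

lemma csmult_add: "csmult c (A + B) = csmult c A + csmult c B"
  by (simp add: csmult_def vec_eq_iff distrib_left)

lemma csmult_diff: "csmult c (A - B) = csmult c A - csmult c B"
  by (simp add: csmult_def vec_eq_iff right_diff_distrib)

lemma csmult_add_scalar: "csmult (c + d) A = csmult c A + csmult d A"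
  by (simp add: csmult_def vec_eq_iff distrib_right)

lemma csmult_csmult [simp]: "csmult c (csmult d A) = csmult (c * d) A"
  by (simp add: csmult_def vec_eq_iff mult.assoc)

lemma csmult_one [simp]: "csmult 1 A = A"
  by (simp add: csmult_def vec_eq_iff)

lemma csmult_zero [simp]: "csmult c 0 = 0" "csmult 0 A = 0"
  by (simp_all add: csmult_def vec_eq_iff)

lemma csmult_neg_one: "csmult (-1) A = - A"
  by (simp add: csmult_def vec_eq_iff)

lemma csmult_of_real: "csmult (complex_of_real r) A = r *\<^sub>R A"
  by (simp add: csmult_def vec_eq_iff) (simp add: scaleR_conv_of_real)

lemma csmult_sum: "csmult c (\<Sum>i\<in>I. f i) = (\<Sum>i\<in>I. csmult c (f i))"
  by (induction I rule: infinite_finite_induct) (auto simp: csmult_add)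

lemma cadj_add: "cadj (A + B) = cadj A + cadj B"
  by (simp add: cadj_def vec_eq_iff)

lemma cadj_diff: "cadj (A - B) = cadj A - cadj B"
  by (simp add: cadj_def vec_eq_iff)

lemma cadj_zero [simp]: "cadj 0 = 0"
  by (simp add: cadj_def vec_eq_iff)

lemma cadj_sum: "cadj (\<Sum>i\<in>I. f i) = (\<Sum>i\<in>I. cadj (f i))"
  by (induction I rule: infinite_finite_induct) (auto simp: cadj_add)

lemma cadj_scaleR [simp]: "cadj (r *\<^sub>R A) = r *\<^sub>R cadj A"
  by (simp add: cadj_def vec_eq_iff)

lemma cadj_csmult [simp]: "cadj (csmult c A) = csmult (cnj c) (cadj A)"
  by (simp add: cadj_def csmult_def vec_eq_iff)

lemma cadj_cadj [simp]: "cadj (cadj A) = A"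
  by (simp add: cadj_def vec_eq_iff)

lemma cadj_mat_1 [simp]: "cadj (mat 1) = mat 1"
  by (simp add: cadj_def mat_def vec_eq_iff)

lemma cadj_mmul: "cadj (A ** B) = cadj B ** cadj A"
  by (simp add: cadj_def matrix_matrix_mult_def vec_eq_iff mult.commute)

lemma trace_csmult [simp]: "trace (csmult c A) = c * trace A"
  by (simp add: trace_def csmult_def sum_distrib_left)

lemma trace_zero [simp]: "trace (0 :: complex^'n^'n) = 0"
  by (simp add: trace_def)

lemma trace_sum: "trace (\<Sum>i\<in>I. f i :: complex^'n^'n) = (\<Sum>i\<in>I. trace (f i))"
  by (induction I rule: infinite_finite_induct) (auto simp: trace_add)

lemma trace_cadj: "trace (cadj A) = cnj (trace A)"
  by (simp add: trace_def cadj_def)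

section \<open>The real Hilbert-Schmidt inner product and its norm\<close>

lemma inner_cvec: "x \<bullet> y = Re (\<Sum>i\<in>UNIV. cnj (x $ i) * y $ i)" for x y :: "complex^'n"
  by (simp add: inner_vec_def inner_complex_def)

lemma trace_cadj_mmul: "trace (cadj A ** B) = (\<Sum>i\<in>UNIV. \<Sum>j\<in>UNIV. cnj (A $ i $ j) * B $ i $ j)"
proof -
  have "trace (cadj A ** B) = (\<Sum>j\<in>UNIV. \<Sum>i\<in>UNIV. cnj (A $ i $ j) * B $ i $ j)"
    by (simp add: trace_def cadj_def matrix_matrix_mult_def)
  also have "\<dots> = (\<Sum>i\<in>UNIV. \<Sum>j\<in>UNIV. cnj (A $ i $ j) * B $ i $ j)" by (rule sum.swap)
  finally show ?thesis .
qed

lemma inner_cmat: "A \<bullet> B = Re (trace (cadj A ** B))" for A B :: "'n::finite cmat"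
  by (simp add: trace_cadj_mmul inner_vec_def inner_complex_def)

lemma trace_cadj_mmul_self: "trace (cadj A ** A) = of_real ((norm A)\<^sup>2)"
proof -
  have "trace (cadj A ** A) = (\<Sum>i\<in>UNIV. \<Sum>j\<in>UNIV. of_real ((cmod (A $ i $ j))\<^sup>2))"
    unfolding trace_cadj_mmul complex_norm_square by (simp add: mult.commute)
  then have "Im (trace (cadj A ** A)) = 0" by simp
  moreover have "Re (trace (cadj A ** A)) = (norm A)\<^sup>2"
    by (simp only: power2_norm_eq_inner inner_cmat)
  ultimately show ?thesis by (simp add: complex_eq_iff)
qed

lemma cadj_mmul_self_eq_zero: "cadj A ** A = 0 \<Longrightarrow> A = 0"
  using trace_cadj_mmul_self[of A] by simp

text \<open>The trace turns the sum into a sum of squared norms. This is how a vanishing sum of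
  squares is split into its terms, both for Kraus operators and for the Casimir element.\<close>

lemma sum_cadj_mmul_eq_zero:
  assumes "finite I" "(\<Sum>i\<in>I. cadj (A i) ** A i) = 0" "i \<in> I"
  shows "A i = 0"
proof -
  have "of_real (\<Sum>i\<in>I. (norm (A i))\<^sup>2) = trace (\<Sum>i\<in>I. cadj (A i) ** A i)"
    by (simp add: trace_sum trace_cadj_mmul_self)
  then have "(\<Sum>i\<in>I. (norm (A i))\<^sup>2) = 0" using assms(2)
    by (metis of_real_eq_0_iff trace_zero)
  then show ?thesis using assms by (simp add: sum_nonneg_eq_0_iff)
qed

lemma cadj_inner_mult: "(A *v x) \<bullet> y = x \<bullet> (cadj A *v y)" for A :: "'n::finite cmat"
proof -
  have "(\<Sum>i\<in>UNIV. cnj ((A *v x) $ i) * y $ i) = (\<Sum>i\<in>UNIV. \<Sum>j\<in>UNIV. cnj (x $ j) * (cnj (A $ i $ j) * y $ i))"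
    by (simp add: matrix_vector_mult_def sum_distrib_left mult_ac)
  also have "\<dots> = (\<Sum>j\<in>UNIV. \<Sum>i\<in>UNIV. cnj (x $ j) * (cnj (A $ i $ j) * y $ i))"
    by (rule sum.swap)
  also have "\<dots> = (\<Sum>j\<in>UNIV. cnj (x $ j) * (cadj A *v y) $ j)"
    by (simp add: matrix_vector_mult_def cadj_def sum_distrib_left)
  finally show ?thesis by (simp add: inner_cvec)
qed

lemma linear_matrix_vector: "linear ((*v) A)" for A :: "'n::finite cmat"
  by (rule linearI) (simp_all add: matrix_vector_mult_def vec_eq_iff distrib_left sum.distrib
      scaleR_sum_right)

lemma matrix_vector_scaleR: "A *v (c *\<^sub>R x) = c *\<^sub>R (A *v x)" "(c *\<^sub>R A) *v x = c *\<^sub>R (A *v x)"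
  for A :: "'n::finite cmat"
  by (simp_all add: matrix_vector_mult_def vec_eq_iff scaleR_sum_right)

section \<open>Self-adjoint elements of a \<open>*\<close>-subalgebra\<close>

lemma subalgebra_diff:
  assumes "unital_cstar_subalgebra B" "X \<in> B" "Y \<in> B"
  shows "X - Y \<in> B"
proof -
  have "X + csmult (-1) Y \<in> B" using assms unfolding unital_cstar_subalgebra_def by blast
  then show ?thesis by (simp add: csmult_neg_one)
qed

lemma subalgebra_scaleR:
  assumes "unital_cstar_subalgebra B" "X \<in> B"
  shows "r *\<^sub>R X \<in> B"
  using assms csmult_of_real unfolding unital_cstar_subalgebra_def by metis

lemma subalgebra_zero:
  assumes "unital_cstar_subalgebra B"
  shows "0 \<in> B"
  using assms csmult_zero(2) unfolding unital_cstar_subalgebra_def by metis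

lemma subalgebra_closed:
  assumes "unital_cstar_subalgebra B"
  shows "mat 1 \<in> B" "X \<in> B \<Longrightarrow> Y \<in> B \<Longrightarrow> X + Y \<in> B" "X \<in> B \<Longrightarrow> Y \<in> B \<Longrightarrow> X ** Y \<in> B"
    "X \<in> B \<Longrightarrow> csmult c X \<in> B" "X \<in> B \<Longrightarrow> cadj X \<in> B"
  using assms unfolding unital_cstar_subalgebra_def by blast+

lemmas subalgebra_intros = subalgebra_closed subalgebra_diff subalgebra_scaleR subalgebra_zero

lemma subalgebra_sum:
  assumes "unital_cstar_subalgebra B" "\<And>i. i \<in> I \<Longrightarrow> f i \<in> B"
  shows "(\<Sum>i\<in>I. f i) \<in> B"
  using assms(2) by (induction I rule: infinite_finite_induct)
    (auto intro: subalgebra_intros[OF assms(1)])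

lemma subspace_subalgebra:
  assumes "unital_cstar_subalgebra B"
  shows "subspace B"
  unfolding subspace_def by (auto intro: subalgebra_intros[OF assms])

section \<open>Kernel projections and the spectral theorem inside a subalgebra\<close>

definition projection :: "'n::finite cmat \<Rightarrow> bool" where
  "projection P \<longleftrightarrow> cadj P = P \<and> P ** P = P"

text \<open>Left multiplication by \<open>Y\<close> is injective on \<open>W\<close>, the set of all
  \<open>Y ** c\<close> with \<open>c\<close> in \<open>B\<close>, because
  \<open>Y ** (Y ** c) = 0\<close> gives \<open>cadj (Y ** c) ** (Y ** c) = 0\<close>. By finite
  dimension it maps \<open>W\<close> onto itself, so \<open>Y = Y ** (Y ** Z)\<close>, and
  \<open>mat 1 - Y ** Z\<close> is the kernel projection, obtained without leaving
  \<open>B\<close>.\<close>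

lemma kernel_projection:
  assumes B: "unital_cstar_subalgebra B" and Y: "Y \<in> B" "cadj Y = Y"
  obtains P Z where "P \<in> B" "projection P" "Y ** P = 0" "Z \<in> B" "mat 1 = P + Y ** Z"
proof -
  note cl = subalgebra_intros[OF B]
  have lin: "linear ((**) Y)"
    by (rule linearI) (auto simp: mmul_distribs)
  define W where "W = (**) Y ` B"
  have W: "subspace W" unfolding W_def using lin subspace_subalgebra[OF B]
    by (rule linear_subspace_image)
  have WB: "W \<subseteq> B" unfolding W_def using cl Y by auto
  have inj: "inj_on ((**) Y) W"
  proof (rule inj_onI)
    fix a b assume "a \<in> W" "b \<in> W" and eq: "Y ** a = Y ** b"
    then have "a - b \<in> W" using W by (simp add: subspace_diff)
    then obtain c where c: "a - b = Y ** c" unfolding W_def by auto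
    have "cadj (a - b) ** (a - b) = cadj c ** (Y ** (a - b))"
      by (simp add: c cadj_mmul Y matrix_mul_assoc)
    also have "\<dots> = 0" using eq by (simp add: mmul_distribs)
    finally have "a - b = 0" by (rule cadj_mmul_self_eq_zero)
    then show "a = b" by simp
  qed
  have "dim ((**) Y ` W) = dim W"
    using dim_image_eq[OF lin, of W] inj W by (simp add: span_eq_iff[THEN iffD2])
  moreover have "(**) Y ` W \<subseteq> W" unfolding W_def using WB W_def by auto
  moreover have "subspace ((**) Y ` W)" using lin W by (rule linear_subspace_image)
  ultimately have "(**) Y ` W = W" using W subspace_dim_equal[of "(**) Y ` W" W] by simp
  moreover have "Y ** mat 1 \<in> W" unfolding W_def using cl(1) by (rule imageI)
  ultimately have "Y \<in> (**) Y ` W" by simp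
  then obtain Z where Z: "Z \<in> B" "Y = Y ** (Y ** Z)"
    unfolding W_def by auto
  define P where "P = mat 1 - Y ** Z"
  have PB: "P \<in> B" unfolding P_def using cl Y Z by auto
  have YP: "Y ** P = 0" unfolding P_def using Z(2) by (simp add: mmul_distribs)
  have PY: "cadj P ** Y = 0" using arg_cong[OF YP, of cadj] Y by (simp add: cadj_mmul)
  have "cadj P ** P = cadj P ** (mat 1 - Y ** Z)" by (simp only: P_def)
  also have "\<dots> = cadj P - (cadj P ** Y) ** Z"
    by (simp add: mmul_diff_right matrix_mul_assoc)
  finally have "cadj P ** P = cadj P - (cadj P ** Y) ** Z" .
  then have PP: "cadj P ** P = cadj P" using PY by simp
  have "cadj (cadj P ** P) = cadj P ** P" by (simp add: cadj_mmul)
  then have h: "cadj P = P" using PP by simp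
  show ?thesis
    by (rule that[of P Z]) (use PB h PP YP Z in \<open>auto simp: projection_def P_def\<close>)
qed

text \<open>A unit vector that maximizes the real quadratic form of \<open>K\<close> on the range of
  \<open>e\<close> is an eigenvector: otherwise moving along the residual
  \<open>l *\<^sub>R x - K *v x\<close> would contradict maximality.\<close>

lemma rayleigh_eigenvector:
  assumes e: "projection e" "e \<noteq> 0" and K: "cadj K = K" "e ** K = K"
  obtains l :: real and x where "x \<noteq> 0" "e *v x = x" "K *v x = l *\<^sub>R x"
proof -
  define R where "R = range ((*v) e)"
  have ee: "e *v (e *v x) = e *v x" for x
    using e by (simp add: matrix_vector_mul_assoc projection_def)
  have R: "y \<in> R \<longleftrightarrow> e *v y = y" for y unfolding R_def using ee by (auto intro: range_eqI sym)
  have sub: "subspace R" unfolding R_def by (rule linear_subspace_image[OF linear_matrix_vector]) auto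
  obtain v where v: "e *v v \<noteq> 0" using e(2) by (metis matrix_eq matrix_vector_mult_0)
  define S where "S = sphere 0 1 \<inter> R"
  have "compact S" unfolding S_def by (rule compact_Int_closed[OF compact_sphere closed_subspace[OF sub]])
  moreover have "(1 / norm (e *v v)) *\<^sub>R (e *v v) \<in> S" unfolding S_def
    using v sub by (auto simp: R_def intro: subspace_scale)
  then have "S \<noteq> {}" by blast
  moreover have "continuous_on S (\<lambda>x. x \<bullet> (K *v x))"
    by (intro continuous_intros linear_continuous_on linear_conv_bounded_linear[THEN iffD1] linear_matrix_vector)
  ultimately obtain x where x: "x \<in> S" and max: "\<And>y. y \<in> S \<Longrightarrow> y \<bullet> (K *v y) \<le> x \<bullet> (K *v x)"
    using continuous_attains_sup by metis
  define l where "l = x \<bullet> (K *v x)"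
  \<comment> \<open>Homogeneity carries maximality from the unit sphere to all of \<open>R\<close>:
    there \<open>q\<close> is nonnegative, and it vanishes at \<open>x\<close>.\<close>
  define q where "q y = l * (y \<bullet> y) - y \<bullet> (K *v y)" for y
  have q: "q y \<ge> 0" if "y \<in> R" for y
  proof (cases "y = 0")
    case False
    have "(1 / norm y) *\<^sub>R y \<in> S" unfolding S_def using False that sub by (auto intro: subspace_scale)
    from max[OF this] have "(y \<bullet> (K *v y)) / (norm y)\<^sup>2 \<le> l"
      by (simp add: l_def matrix_vector_scaleR power2_eq_square)
    then show ?thesis using False by (simp add: q_def power2_norm_eq_inner divide_simps mult.commute)
  qed (simp add: q_def)
  have x1: "x \<bullet> x = 1" and xR: "x \<in> R" using x by (auto simp: S_def norm_eq_1)
  define z where "z = l *\<^sub>R x - K *v x"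
  have "K *v x \<in> R" using K by (simp add: R matrix_vector_mul_assoc)
  then have zR: "z \<in> R" unfolding z_def using sub xR by (simp add: subspace_diff subspace_scale)
  have sym: "z \<bullet> (K *v x) = x \<bullet> (K *v z)"
    using cadj_inner_mult[of K x z] K by (simp add: inner_commute)
  have expand: "q (x + t *\<^sub>R z) = 2 * t * (z \<bullet> z) + t\<^sup>2 * q z" for t
  proof -
    have "q (x + t *\<^sub>R z) = (l * (x \<bullet> x) - x \<bullet> (K *v x)) + t * (2 * (l * (x \<bullet> z)) - z \<bullet> (K *v x) - x \<bullet> (K *v z)) + t\<^sup>2 * q z"
      by (simp add: q_def matrix_vector_right_distrib matrix_vector_scaleR inner_simps
          algebra_simps power2_eq_square inner_commute)
    also have "l * (x \<bullet> x) - x \<bullet> (K *v x) = 0" by (simp add: x1 l_def)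
    also have "2 * (l * (x \<bullet> z)) - z \<bullet> (K *v x) - x \<bullet> (K *v z) = 2 * (z \<bullet> (l *\<^sub>R x - K *v x))"
      using sym by (simp add: inner_simps inner_commute)
    finally show ?thesis unfolding z_def[symmetric] by simp
  qed
  have "z = 0"
  proof (rule ccontr)
    assume "z \<noteq> 0"
    then have pos: "z \<bullet> z > 0" by simp
    \<comment> \<open>Negative, and so small that the quadratic term in \<open>expand\<close> cannot
      compensate the linear one; the \<open>+ 1\<close> also covers \<open>q z = 0\<close>.\<close>
    define t where "t = - (z \<bullet> z) / (q z + 1)"
    have qz: "q z \<ge> 0" using q zR by blast
    have "0 \<le> q (x + t *\<^sub>R z)" using sub xR zR by (intro q) (simp add: subspace_add subspace_scale)
    also have "\<dots> = t * (2 * (z \<bullet> z) + t * q z)" unfolding expand by (simp add: algebra_simps power2_eq_square)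
    finally have "0 \<le> t * (2 * (z \<bullet> z) + t * q z)" .
    moreover have "t < 0" unfolding t_def using pos qz by (simp add: divide_simps)
    ultimately have "2 * (z \<bullet> z) + t * q z \<le> 0" by (simp add: zero_le_mult_iff)
    moreover have "t * q z \<ge> - (z \<bullet> z)" unfolding t_def using pos qz by (simp add: divide_simps algebra_simps)
    ultimately show False using pos by linarith
  qed
  then have "K *v x = l *\<^sub>R x" by (simp add: z_def)
  moreover have "x \<noteq> 0" using x1 by auto
  ultimately show ?thesis using that[of x l] xR by (simp add: R)
qed

text \<open>Induction on the dimension of the range of \<open>e\<close>: an eigenvector of
  \<open>K\<close> in that range supplies an eigenvalue, whose spectral projection \<open>p\<close>
  lies in \<open>B\<close>, and the rest of \<open>K\<close> lives below
  \<open>e - p\<close>.\<close>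

lemma spectral_decomposition_below:
  fixes e K :: "'n::finite cmat"
  assumes B: "unital_cstar_subalgebra B"
    and "e \<in> B" "projection e" "K \<in> B" "cadj K = K" "e ** K = K"
  shows "\<exists>Q (l :: 'n cmat \<Rightarrow> real). finite Q \<and> Q \<subseteq> B \<and>
    (\<forall>P\<in>Q. projection P \<and> P \<noteq> 0 \<and> e ** P = P) \<and>
    (\<forall>P\<in>Q. \<forall>P'\<in>Q. P \<noteq> P' \<longrightarrow> P ** P' = 0) \<and> K = (\<Sum>P\<in>Q. l P *\<^sub>R P)"
  using assms(2-)
proof (induction "dim (range ((*v) e))" arbitrary: e K rule: less_induct)
  case less
  note cl = subalgebra_intros[OF B]
  show ?case
  proof (cases "e = 0")
    case True
    then have "K = 0" using less.prems by simp
    then show ?thesis by (intro exI[of _ "{}"]) auto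
  next
    case False
    have he: "cadj e = e" "e ** e = e" using less.prems by (auto simp: projection_def)
    have Ke: "K ** e = K" using arg_cong[OF less.prems(5), of cadj] less.prems(4) he
      by (simp add: cadj_mmul)
    obtain l x where x: "x \<noteq> 0" "e *v x = x" "K *v x = l *\<^sub>R x"
      using rayleigh_eigenvector[OF less.prems(2) False less.prems(4,5)] by blast
    \<comment> \<open>The summand \<open>mat 1 - e\<close> makes \<open>Y\<close> the identity on
      the range of \<open>mat 1 - e\<close>, so the kernel of \<open>Y\<close> is the
      \<open>l\<close>-eigenspace of \<open>K\<close> inside the range of \<open>e\<close>.\<close>
    define Y where "Y = l *\<^sub>R e - K + (mat 1 - e)"
    have YB: "Y \<in> B" unfolding Y_def using less.prems cl by auto
    have Yh: "cadj Y = Y" unfolding Y_def using less.prems he by (simp add: cadj_add cadj_diff)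
    obtain p Z where p: "p \<in> B" "projection p" "Y ** p = 0" "Z \<in> B" "mat 1 = p + Y ** Z"
      using kernel_projection[OF B YB Yh] by blast
    have hp: "cadj p = p" "p ** p = p" using p by (auto simp: projection_def)
    have pY: "p ** Y = 0" using arg_cong[OF p(3), of cadj] hp Yh by (simp add: cadj_mmul)
    have "e ** Y = l *\<^sub>R e - K" unfolding Y_def using he less.prems by (simp add: mmul_distribs)
    then have "(l *\<^sub>R e - K) ** p = e ** (Y ** p)" by (simp add: matrix_mul_assoc)
    moreover have "Y ** p = (l *\<^sub>R e - K) ** p + (p - e ** p)"
      unfolding Y_def by (simp add: mmul_distribs)
    ultimately have ep: "e ** p = p" using p(3) by simp
    have pe: "p ** e = p" using arg_cong[OF ep, of cadj] hp he by (simp add: cadj_mmul)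
    have Kp: "K ** p = l *\<^sub>R p" using p(3) ep unfolding Y_def by (simp add: mmul_distribs)
    have pK: "p ** K = l *\<^sub>R p" using arg_cong[OF Kp, of cadj] hp less.prems by (simp add: cadj_mmul)
    \<comment> \<open>As \<open>Y\<close> kills \<open>x\<close>, the projection \<open>p\<close>
      fixes it. So \<open>p\<close> is nonzero, and \<open>x\<close> leaves the range when
      \<open>e\<close> shrinks to \<open>e - p\<close>, which makes the induction decrease.\<close>
    have "Y *v x = 0" unfolding Y_def using x
      by (simp add: matrix_vector_mult_add_rdistrib matrix_vector_mult_diff_rdistrib matrix_vector_scaleR)
    moreover have "mat 1 = p + cadj Z ** Y" using arg_cong[OF p(5), of cadj] hp Yh
      by (simp add: cadj_mmul cadj_add)
    then have "x = p *v x + cadj Z *v (Y *v x)"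
      by (metis matrix_vector_mul_assoc matrix_vector_mul_lid matrix_vector_mult_add_rdistrib)
    ultimately have px: "p *v x = x" by simp
    then have p0: "p \<noteq> 0" using x(1) by auto
    define e' where "e' = e - p"
    define K' where "K' = K - l *\<^sub>R p"
    have e': "e' \<in> B" "projection e'" "K' \<in> B" "cadj K' = K'" "e' ** K' = K'"
      using less.prems p cl hp he ep pe pK Kp unfolding e'_def K'_def projection_def
      by (auto simp: mmul_distribs cadj_diff)
    have ee': "e ** e' = e'" and e'p: "e' ** p = 0" and pe': "p ** e' = 0"
      unfolding e'_def using he hp ep pe by (auto simp: mmul_distribs)
    have "range ((*v) e') \<subset> range ((*v) e)"
    proof
      show "range ((*v) e') \<subseteq> range ((*v) e)"
      proof
        fix y assume "y \<in> range ((*v) e')"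
        then obtain u where "y = e' *v u" by auto
        then have "y = e *v (e' *v u)" by (simp add: matrix_vector_mul_assoc ee')
        then show "y \<in> range ((*v) e)" by blast
      qed
      have "x \<notin> range ((*v) e')"
      proof
        assume "x \<in> range ((*v) e')"
        then obtain y where "x = e' *v y" by auto
        then have "p *v x = (p ** e') *v y" by (simp add: matrix_vector_mul_assoc)
        then show False using pe' px x(1) by simp
      qed
      then show "range ((*v) e') \<noteq> range ((*v) e)" using x(2) by (metis rangeI)
    qed
    then have "dim (range ((*v) e')) < dim (range ((*v) e))"
      by (metis dim_psubset linear_matrix_vector linear_subspace_image span_eq_iff subspace_UNIV)
    from less.hyps[OF this e'] obtain Q and f :: "'n cmat \<Rightarrow> real" where Q: "finite Q" "Q \<subseteq> B" 
      "\<forall>P\<in>Q. projection P \<and> P \<noteq> 0 \<and> e' ** P = P"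
      "\<forall>P\<in>Q. \<forall>P'\<in>Q. P \<noteq> P' \<longrightarrow> P ** P' = 0" "K' = (\<Sum>P\<in>Q. f P *\<^sub>R P)" by blast
    have pP: "p ** P = 0" if "P \<in> Q" for P
      using Q(3) that pe' by (metis matrix_mul_assoc mmul_zero_left)
    have Pp: "P ** p = 0" if "P \<in> Q" for P
      using arg_cong[OF pP[OF that], of cadj] that Q(3) hp by (simp add: cadj_mmul projection_def)
    have pQ: "p \<notin> Q" using pP p0 hp by metis
    have "K = (\<Sum>P\<in>insert p Q. (f(p := l)) P *\<^sub>R P)"
    proof -
      have "(\<Sum>P\<in>Q. (f(p := l)) P *\<^sub>R P) = (\<Sum>P\<in>Q. f P *\<^sub>R P)"
        using pQ by (intro sum.cong) auto
      then show ?thesis using Q(1,5) pQ unfolding K'_def by (simp add: algebra_simps)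
    qed
    moreover have "e ** P = P" if "P \<in> Q" for P
      using Q(3) that ee' by (metis matrix_mul_assoc)
    ultimately show ?thesis
      by (intro exI[of _ "insert p Q"] exI[of _ "f(p := l)"])
        (use Q p p0 ep pP Pp in auto)
  qed
qed

lemma spectral_decomposition:
  fixes K :: "'n::finite cmat"
  assumes B: "unital_cstar_subalgebra B" and "K \<in> B" "cadj K = K"
  obtains Q and l :: "'n cmat \<Rightarrow> real" where "finite Q" "Q \<subseteq> B"
    "\<And>P. P \<in> Q \<Longrightarrow> projection P" "\<And>P. P \<in> Q \<Longrightarrow> P \<noteq> 0"
    "\<And>P P'. P \<in> Q \<Longrightarrow> P' \<in> Q \<Longrightarrow> P \<noteq> P' \<Longrightarrow> P ** P' = 0"
    "K = (\<Sum>P\<in>Q. l P *\<^sub>R P)"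
  using spectral_decomposition_below[OF B, of "mat 1" K] assms(2,3) subalgebra_closed(1)[OF B] that
  by (auto simp: projection_def)

section \<open>Complex-linear maps and their values on projections\<close>

lemma clinear_mapD:
  assumes "clinear_map F"
  shows "F (A + B) = F A + F B" "F (csmult c A) = csmult c (F A)"
  using assms unfolding clinear_map_def by blast+

lemma clinear_map_linear: "clinear_map F \<Longrightarrow> linear F"
  unfolding clinear_map_def by (auto intro!: linearI simp flip: csmult_of_real)

lemma clinear_map_sum: "clinear_map F \<Longrightarrow> F (\<Sum>i\<in>I. f i) = (\<Sum>i\<in>I. F (f i))"
  by (simp add: clinear_map_linear linear_sum)

lemma hermitian_parts:
  assumes B: "unital_cstar_subalgebra B" and "X \<in> B"
  obtains H K where "H \<in> B" "cadj H = H" "K \<in> B" "cadj K = K" "X = H + csmult \<i> K"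
proof
  note cl = subalgebra_intros[OF B]
  define H where "H = csmult (1/2) (X + cadj X)"
  define K where "K = csmult (- \<i>/2) (X - cadj X)"
  show "H \<in> B" "K \<in> B" unfolding H_def K_def using assms cl by auto
  show "cadj H = H" "cadj K = K" unfolding H_def K_def
    by (simp_all add: cadj_def csmult_def vec_eq_iff field_simps)
  show "X = H + csmult \<i> K" unfolding H_def K_def
    by (simp add: csmult_def vec_eq_iff cadj_def algebra_simps)
qed

text \<open>The projections of \<open>B\<close> span it over the complex numbers, by Hermitian parts
  and the spectral decomposition.\<close>

lemma clinear_eq_on_projections:
  assumes B: "unital_cstar_subalgebra B" and F: "clinear_map F" and G: "clinear_map G"
    and eq: "\<And>P. P \<in> B \<Longrightarrow> projection P \<Longrightarrow> F P = G P" and "X \<in> B"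
  shows "F X = G X"
proof -
  have herm: "F K = G K" if K: "K \<in> B" "cadj K = K" for K
  proof -
    obtain Q and l :: "'a cmat \<Rightarrow> real" where "finite Q" "Q \<subseteq> B"
      "\<And>P. P \<in> Q \<Longrightarrow> projection P" "\<And>P. P \<in> Q \<Longrightarrow> P \<noteq> 0"
      "\<And>P P'. P \<in> Q \<Longrightarrow> P' \<in> Q \<Longrightarrow> P \<noteq> P' \<Longrightarrow> P ** P' = 0"
      "K = (\<Sum>P\<in>Q. l P *\<^sub>R P)"
      by (rule spectral_decomposition[OF B K]) blast
    then show ?thesis using eq
      by (auto simp: clinear_map_sum[OF F] clinear_map_sum[OF G] linear_scale[OF clinear_map_linear[OF F]]
          linear_scale[OF clinear_map_linear[OF G]] subset_iff intro!: sum.cong)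
  qed
  obtain H K where "H \<in> B" "cadj H = H" "K \<in> B" "cadj K = K" "X = H + csmult \<i> K"
    using hermitian_parts[OF B \<open>X \<in> B\<close>] by metis
  then show ?thesis using herm by (simp add: clinear_mapD[OF F] clinear_mapD[OF G])
qed

section \<open>The Casimir element of a \<open>*\<close>-subalgebra\<close>

text \<open>Modelled on a Hermitian orthonormal basis for the trace form, of which only the
  expansion formula is recorded. The sum of \<open>b\<close> tensor \<open>b\<close> over
  \<open>D\<close> plays the part of the Casimir element of \<open>B\<close>.\<close>

definition casimir_basis :: "'n::finite cmat set \<Rightarrow> 'n cmat set \<Rightarrow> bool" where
  "casimir_basis B D \<longleftrightarrow> finite D \<and> D \<subseteq> B \<and> (\<forall>b\<in>D. cadj b = b) \<and>
     (\<forall>X\<in>B. X = (\<Sum>b\<in>D. csmult (trace (b ** X)) b))"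

text \<open>Between Hermitian matrices the trace form is real and equals the real inner product, so
  a real orthonormal basis of the Hermitian part of \<open>B\<close> serves; its expansion extends
  complex-linearly.\<close>

lemma casimir_basis_exists:
  assumes B: "unital_cstar_subalgebra B"
  obtains D where "casimir_basis B D"
proof -
  note cl = subalgebra_intros[OF B]
  define H where "H = {X \<in> B. cadj X = X}"
  have "subspace H" unfolding H_def subspace_def using cl by (auto simp: cadj_add)
  then obtain D where D: "D \<subseteq> H" "pairwise orthogonal D" "\<And>b. b \<in> D \<Longrightarrow> norm b = 1"
     "independent D" "span D = H"
    using orthonormal_basis_subspace by metis
  have fin: "finite D" using D(4) by (rule independent_imp_finite)
  have real: "of_real (b \<bullet> K) = trace (b ** K)" if "b \<in> H" "K \<in> H" for b K
  proof -
    have "cnj (trace (b ** K)) = trace (b ** K)"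
      using that trace_mul_sym[of K b] by (simp add: cadj_mmul H_def flip: trace_cadj)
    then show ?thesis using that by (simp add: inner_cmat H_def complex_eq_iff)
  qed
  have herm: "(\<Sum>b\<in>D. csmult (trace (b ** K)) b) = K" if K: "K \<in> H" for K
  proof -
    have "(\<Sum>b\<in>D. (K \<bullet> b) *\<^sub>R b) = K"
      using D fin K by (intro orthonormal_basis_expand) auto
    moreover have "(\<Sum>b\<in>D. (K \<bullet> b) *\<^sub>R b) = (\<Sum>b\<in>D. csmult (trace (b ** K)) b)"
      using D(1) real K by (intro sum.cong) (auto simp: inner_commute[of K] simp flip: csmult_of_real)
    ultimately show ?thesis by simp
  qed
  have "X = (\<Sum>b\<in>D. csmult (trace (b ** X)) b)" if X: "X \<in> B" for X
  proof -
    obtain K L where KL: "K \<in> H" "L \<in> H" "X = K + csmult \<i> L"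
      using hermitian_parts[OF B X] unfolding H_def by blast
    have "(\<Sum>b\<in>D. csmult (trace (b ** X)) b)
        = (\<Sum>b\<in>D. csmult (trace (b ** K)) b) + csmult \<i> (\<Sum>b\<in>D. csmult (trace (b ** L)) b)"
      unfolding KL(3) by (simp add: mmul_distribs trace_add csmult_add_scalar sum.distrib csmult_sum)
    then show ?thesis using herm KL by simp
  qed
  then show ?thesis using that[of D] fin D(1) unfolding casimir_basis_def H_def by blast
qed

text \<open>The bilinear \<open>\<phi>\<close> stands for a linear map on the tensor square.
  Expanding in the basis and using cyclicity of the trace moves a factor \<open>x\<close> from the
  first leg to the opposite side of the second leg.\<close>

lemma casimir_move:
  assumes B: "unital_cstar_subalgebra B" and D: "casimir_basis B D"
    and lin: "\<And>Y. clinear_map (\<lambda>X. \<phi> X Y)" "\<And>X. clinear_map (\<phi> X)" and x: "x \<in> B"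
  shows "(\<Sum>b\<in>D. \<phi> (x ** b) b) = (\<Sum>b\<in>D. \<phi> b (b ** x))"
    and "(\<Sum>b\<in>D. \<phi> (b ** x) b) = (\<Sum>b\<in>D. \<phi> b (x ** b))"
proof -
  note cl = subalgebra_intros[OF B]
  have DB: "b \<in> B" if "b \<in> D" for b using D that unfolding casimir_basis_def by blast
  have expand: "X = (\<Sum>b\<in>D. csmult (trace (b ** X)) b)" if "X \<in> B" for X
    using D that unfolding casimir_basis_def by blast
  have left: "\<phi> X Y = (\<Sum>c\<in>D. csmult (trace (c ** X)) (\<phi> c Y))" if "X \<in> B" for X Y
    by (subst expand[OF that]) (simp add: clinear_map_sum[OF lin(1)] clinear_mapD[OF lin(1)])
  have right: "\<phi> Y X = (\<Sum>c\<in>D. csmult (trace (c ** X)) (\<phi> Y c))" if "X \<in> B" for X Y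
    by (subst expand[OF that]) (simp add: clinear_map_sum[OF lin(2)] clinear_mapD[OF lin(2)])
  have cyc: "trace (b ** (c ** x)) = trace (c ** (x ** b))" for b c
    using trace_mul_sym[of b "c ** x"] by (simp add: matrix_mul_assoc)
  have "(\<Sum>b\<in>D. \<phi> (x ** b) b) = (\<Sum>b\<in>D. \<Sum>c\<in>D. csmult (trace (c ** (x ** b))) (\<phi> c b))"
    using left x DB cl by (intro sum.cong) auto
  also have "\<dots> = (\<Sum>c\<in>D. \<Sum>b\<in>D. csmult (trace (b ** (c ** x))) (\<phi> c b))"
    by (subst sum.swap) (simp only: cyc)
  also have "\<dots> = (\<Sum>c\<in>D. \<phi> c (c ** x))"
    using right x DB cl by (intro sum.cong) auto
  finally show "(\<Sum>b\<in>D. \<phi> (x ** b) b) = (\<Sum>b\<in>D. \<phi> b (b ** x))" .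
  have "(\<Sum>b\<in>D. \<phi> (b ** x) b) = (\<Sum>b\<in>D. \<Sum>c\<in>D. csmult (trace (c ** (b ** x))) (\<phi> c b))"
    using left x DB cl by (intro sum.cong) auto
  also have "\<dots> = (\<Sum>c\<in>D. \<Sum>b\<in>D. csmult (trace (b ** (x ** c))) (\<phi> c b))"
    by (subst sum.swap) (simp only: cyc)
  also have "\<dots> = (\<Sum>c\<in>D. \<phi> c (x ** c))"
    using right x DB cl by (intro sum.cong) auto
  finally show "(\<Sum>b\<in>D. \<phi> (b ** x) b) = (\<Sum>b\<in>D. \<phi> b (x ** b))" .
qed

lemma clinear_mmul: "clinear_map (\<lambda>X. A ** X ** C)" "clinear_map (\<lambda>X. X ** C)" "clinear_map (\<lambda>X. A ** X)"
  by (auto simp: clinear_map_def mmul_distribs)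

lemma clinear_map_compose: "clinear_map F \<Longrightarrow> clinear_map G \<Longrightarrow> clinear_map (\<lambda>X. F (G X))"
  by (simp add: clinear_map_def)

lemma casimir_central:
  assumes B: "unital_cstar_subalgebra B" and D: "casimir_basis B D" and x: "x \<in> B"
  shows "x ** (\<Sum>b\<in>D. b ** b) = (\<Sum>b\<in>D. b ** b) ** x"
  using casimir_move(1)[OF B D _ _ x, of "(**)"] 
  by (simp add: clinear_mmul mmul_sum_left mmul_sum_right matrix_mul_assoc)

text \<open>If \<open>p\<close> is the kernel projection of the sum, then the squares
  \<open>cadj (b ** p) ** (b ** p)\<close> add up to 0, so every \<open>b ** p\<close> vanishes;
  expanding \<open>mat 1\<close> in the basis gives \<open>p = 0\<close>. The inverse inherits
  centrality.\<close>

lemma casimir_invertible: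
  assumes B: "unital_cstar_subalgebra B" and D: "casimir_basis B D"
  obtains Z where "Z \<in> B" "(\<Sum>b\<in>D. b ** b) ** Z = mat 1" "Z ** (\<Sum>b\<in>D. b ** b) = mat 1"
    "\<And>x. x \<in> B \<Longrightarrow> Z ** x = x ** Z"
proof -
  note cl = subalgebra_intros[OF B]
  define C where "C = (\<Sum>b\<in>D. b ** b)"
  have fin: "finite D" and DB: "\<And>b. b \<in> D \<Longrightarrow> b \<in> B" and h: "\<And>b. b \<in> D \<Longrightarrow> cadj b = b"
    using D unfolding casimir_basis_def by auto
  have CB: "C \<in> B" unfolding C_def using DB cl by (intro subalgebra_sum[OF B]) auto
  have Ch: "cadj C = C" unfolding C_def by (simp add: cadj_sum cadj_mmul h cong: sum.cong)
  obtain p Z where p: "p \<in> B" "projection p" "C ** p = 0" "Z \<in> B" "mat 1 = p + C ** Z"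
    using kernel_projection[OF B CB Ch] by blast
  have "(\<Sum>b\<in>D. cadj (b ** p) ** (b ** p)) = cadj p ** (C ** p)"
    unfolding C_def by (simp add: mmul_sum_left mmul_sum_right cadj_mmul h matrix_mul_assoc cong: sum.cong)
  then have bp: "b ** p = 0" if "b \<in> D" for b
    using sum_cadj_mmul_eq_zero[OF fin _ that, of "\<lambda>b. b ** p"] p(3) by simp
  have "mat 1 = (\<Sum>b\<in>D. csmult (trace (b ** mat 1)) b)"
    using D cl(1) unfolding casimir_basis_def by blast
  then have "mat 1 ** p = (\<Sum>b\<in>D. csmult (trace (b ** mat 1)) (b ** p))"
    by (metis (no_types, lifting) csmult_mmul_left mmul_sum_left sum.cong)
  then have "p = 0" using bp by simp
  then have CZ: "C ** Z = mat 1" using p(5) by simp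
  then have ZC: "Z ** C = mat 1" by (simp add: matrix_left_right_inverse)
  have "Z ** x = x ** Z" if "x \<in> B" for x
  proof -
    have "Z ** x = Z ** (x ** C) ** Z" using CZ by (simp flip: matrix_mul_assoc)
    also have "\<dots> = (Z ** C) ** x ** Z" using casimir_central[OF B D that] by (simp add: C_def matrix_mul_assoc)
    finally show ?thesis using ZC by simp
  qed
  then show ?thesis using that p(4) CZ ZC unfolding C_def by blast
qed

section \<open>Forms that are constant on unitaries\<close>

text \<open>A sesquilinear form \<open>h\<close> is represented by the bilinear form \<open>\<beta> X Y = h (cadj X) Y\<close>, so that
  \<open>h V V\<close> reads \<open>\<beta> (cadj V) V\<close>.\<close>

definition cbilinear_form :: "('n::finite cmat \<Rightarrow> 'n cmat \<Rightarrow> complex) \<Rightarrow> bool" where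
  "cbilinear_form \<beta> \<longleftrightarrow>
     (\<forall>X X' Y. \<beta> (X + X') Y = \<beta> X Y + \<beta> X' Y) \<and> (\<forall>X Y Y'. \<beta> X (Y + Y') = \<beta> X Y + \<beta> X Y') \<and>
     (\<forall>c X Y. \<beta> (csmult c X) Y = c * \<beta> X Y) \<and> (\<forall>c X Y. \<beta> X (csmult c Y) = c * \<beta> X Y)"

lemma cbilinear_formD:
  assumes "cbilinear_form \<beta>"
  shows "\<beta> (X + X') Y = \<beta> X Y + \<beta> X' Y" "\<beta> X (Y + Y') = \<beta> X Y + \<beta> X Y'"
    "\<beta> (csmult c X) Y = c * \<beta> X Y" "\<beta> X (csmult c Y) = c * \<beta> X Y"
  using assms unfolding cbilinear_form_def by blast+

lemma cbilinear_form_simps: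
  assumes "cbilinear_form \<beta>"
  shows "\<beta> 0 Y = 0" "\<beta> X 0 = 0" "\<beta> (- X) Y = - \<beta> X Y" "\<beta> X (- Y) = - \<beta> X Y"
    "\<beta> (X - X') Y = \<beta> X Y - \<beta> X' Y" "\<beta> X (Y - Y') = \<beta> X Y - \<beta> X Y'"
    "\<beta> (r *\<^sub>R X) Y = of_real r * \<beta> X Y" "\<beta> X (r *\<^sub>R Y) = of_real r * \<beta> X Y"
    "\<beta> (sum f I) Y = (\<Sum>i\<in>I. \<beta> (f i) Y)" "\<beta> X (sum f I) = (\<Sum>i\<in>I. \<beta> X (f i))"
proof -
  note bl = cbilinear_formD[OF assms]
  show z: "\<beta> 0 Y = 0" "\<beta> X 0 = 0" using bl(3)[of 0 0] bl(4)[of _ 0 0] by simp_all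
  have m: "\<beta> (- X) Y = - \<beta> X Y" "\<beta> X (- Y) = - \<beta> X Y" for X Y
    using bl(3)[of "-1"] bl(4)[of _ "-1"] by (simp_all add: csmult_neg_one)
  then show "\<beta> (- X) Y = - \<beta> X Y" "\<beta> X (- Y) = - \<beta> X Y" by auto
  show "\<beta> (X - X') Y = \<beta> X Y - \<beta> X' Y" using bl(1)[of X "- X'"] m by simp
  show "\<beta> X (Y - Y') = \<beta> X Y - \<beta> X Y'" using bl(2)[of X Y "- Y'"] m by simp
  show "\<beta> (r *\<^sub>R X) Y = of_real r * \<beta> X Y" "\<beta> X (r *\<^sub>R Y) = of_real r * \<beta> X Y"
    using bl(3,4) csmult_of_real by metis+
  show "\<beta> (sum f I) Y = (\<Sum>i\<in>I. \<beta> (f i) Y)" "\<beta> X (sum f I) = (\<Sum>i\<in>I. \<beta> X (f i))"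
    by (induction I rule: infinite_finite_induct) (auto simp: bl z)
qed

text \<open>Through the trace form, \<open>\<omega>\<close> becomes a linear map \<open>d\<close>.
  The two hypotheses on \<open>\<omega>\<close> make \<open>d\<close> a Jordan derivation of
  \<open>B\<close>, and the Casimir element exhibits it as a commutator.\<close>

lemma antisymmetric_form_eq_commutator:
  assumes B: "unital_cstar_subalgebra B" and \<omega>: "cbilinear_form \<omega>"
    and anti: "\<And>X Y. X \<in> B \<Longrightarrow> Y \<in> B \<Longrightarrow> \<omega> X Y = - \<omega> Y X"
    and jordan: "\<And>X. X \<in> B \<Longrightarrow> cadj X = X \<Longrightarrow> \<omega> X (X ** X) = 0"
  obtains T where "\<And>X Y. X \<in> B \<Longrightarrow> Y \<in> B \<Longrightarrow> \<omega> Y X = trace (Y ** (T ** X - X ** T))"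
proof -
  note cl = subalgebra_intros[OF B]
  note bl = cbilinear_formD[OF \<omega>] cbilinear_form_simps[OF \<omega>]
  obtain D where D: "casimir_basis B D" using casimir_basis_exists[OF B] by blast
  then have DB: "\<And>b. b \<in> D \<Longrightarrow> b \<in> B" and h: "\<And>b. b \<in> D \<Longrightarrow> cadj b = b"
    and expand: "\<And>X. X \<in> B \<Longrightarrow> X = (\<Sum>b\<in>D. csmult (trace (b ** X)) b)"
    unfolding casimir_basis_def by auto
  \<comment> \<open>The Riesz representation of \<open>\<omega>\<close> for the trace form:
    \<open>trace (Y ** d X) = \<omega> Y X\<close> on \<open>B\<close>.\<close>
  define d where "d X = (\<Sum>b\<in>D. csmult (\<omega> b X) b)" for X
  have d_lin: "clinear_map d" unfolding clinear_map_def d_def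
    by (simp add: bl csmult_add_scalar sum.distrib csmult_sum)
  have dB: "d X \<in> B" for X unfolding d_def using DB cl by (intro subalgebra_sum[OF B]) auto
  have d: "trace (Y ** d X) = \<omega> Y X" if "Y \<in> B" for X Y
  proof -
    have "\<omega> Y X = (\<Sum>b\<in>D. trace (b ** Y) * \<omega> b X)"
      by (subst expand[OF that]) (simp add: bl)
    then show ?thesis unfolding d_def
      by (simp add: mmul_sum_right trace_sum trace_mul_sym[of Y] mult.commute)
  qed
  have nondeg: "X = 0" if "X \<in> B" "\<And>Y. Y \<in> B \<Longrightarrow> cadj Y = Y \<Longrightarrow> trace (Y ** X) = 0" for X
    using expand[OF that(1)] that(2) DB h by simp
  have d_square: "d (K ** K) = d K ** K + K ** d K" if K: "K \<in> B" "cadj K = K" for K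
  proof -
    have "d (K ** K) - (d K ** K + K ** d K) = 0"
    proof (rule nondeg)
      show "d (K ** K) - (d K ** K + K ** d K) \<in> B" using dB K cl by auto
      fix y assume y: "y \<in> B" "cadj y = y"
      \<comment> \<open>Polarization: subtracting the values of the cubic expression at
        \<open>K + y\<close> and \<open>K - y\<close>, and its value at \<open>y\<close>, isolates
        the part linear in \<open>y\<close>.\<close>
      have e1: "\<omega> (K + y) ((K + y) ** (K + y)) = 0"
        by (rule jordan) (use K y cl in \<open>auto simp: cadj_add\<close>)
      have e2: "\<omega> (K - y) ((K - y) ** (K - y)) = 0"
        by (rule jordan) (use K y cl in \<open>auto simp: cadj_diff\<close>)
      have "2 * (\<omega> y (K ** K) + \<omega> K (K ** y + y ** K))
        = \<omega> (K + y) ((K + y) ** (K + y)) - \<omega> (K - y) ((K - y) ** (K - y)) - 2 * \<omega> y (y ** y)"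
        by (simp add: bl mmul_distribs algebra_simps)
      then have "2 * (\<omega> y (K ** K) + \<omega> K (K ** y + y ** K)) = 0"
        by (simp only: e1 e2 jordan[OF y]) simp
      then have "\<omega> y (K ** K) + \<omega> K (K ** y + y ** K) = 0"
        by (simp only: mult_eq_0_iff) simp
      then have "\<omega> y (K ** K) = \<omega> (K ** y + y ** K) K"
        using anti[of K "K ** y + y ** K"] K y cl by (simp add: algebra_simps)
      also have "\<dots> = trace ((K ** y + y ** K) ** d K)" using d K y cl by metis
      also have "\<dots> = trace (y ** (d K ** K + K ** d K))"
        using trace_mul_sym[of K "y ** d K"] by (simp add: mmul_distribs trace_add matrix_mul_assoc)
      finally show "trace (y ** (d (K ** K) - (d K ** K + K ** d K))) = 0"
        using d[OF y(1)] by (simp add: mmul_distribs trace_sub)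
    qed
    then show ?thesis by simp
  qed
  have d_jordan: "d (K ** L + L ** K) = d K ** L + K ** d L + d L ** K + L ** d K"
    if K: "K \<in> B" "cadj K = K" and L: "L \<in> B" "cadj L = L" for K L
  proof -
    have "d ((K + L) ** (K + L)) = d (K + L) ** (K + L) + (K + L) ** d (K + L)"
      using d_square[of "K + L"] K L cl by (simp add: cadj_add)
    then show ?thesis using d_square[OF K] d_square[OF L]
      by (simp add: mmul_distribs clinear_mapD[OF d_lin] algebra_simps)
  qed
  define C where "C = (\<Sum>b\<in>D. b ** b)"
  \<comment> \<open>If \<open>d\<close> were the commutator with some \<open>A\<close>, this sum
    would be \<open>A ** C\<close> minus \<Sum> \<open>b ** A ** b\<close>, and the latter commutes
    with \<open>B\<close>. So \<open>T\<close> times the inverse of \<open>C\<close> is the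
    candidate implementing \<open>d\<close>.\<close>
  define T where "T = (\<Sum>b\<in>D. d b ** b)"
  have key: "T ** x = d x ** C + x ** T" if x: "x \<in> B" "projection x" for x
  proof -
    have hx: "cadj x = x" "x ** x = x" using x by (auto simp: projection_def)
    have "d x = d x ** x + x ** d x" using d_square[of x] x hx by simp
    then have "x ** d x ** x = x ** (d x ** x + x ** d x) ** x" by simp
    also have "\<dots> = x ** d x ** (x ** x) + (x ** x) ** d x ** x"
      by (simp add: mmul_distribs matrix_mul_assoc)
    finally have xdx: "x ** d x ** x = 0" by (simp add: hx)
    \<comment> \<open>The map sending \<open>w\<close> to \<Sum> \<open>b ** w ** b\<close> behaves
      like a trace. Since a Jordan derivation satisfies \<open>x ** d x ** x = 0\<close> at a
      projection, the map kills \<open>d x\<close>.\<close>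
    have trac: "(\<Sum>b\<in>D. b ** (u ** v) ** b) = (\<Sum>b\<in>D. b ** (v ** u) ** b)" if "u \<in> B" for u v
    proof -
      have "clinear_map (\<lambda>X. X ** v ** Y)" for Y by (simp add: clinear_map_def mmul_distribs)
      then show ?thesis using casimir_move(2)[OF B D _ _ that, of "\<lambda>X Y. X ** v ** Y"]
        by (simp add: clinear_mmul matrix_mul_assoc)
    qed
    have "(\<Sum>b\<in>D. b ** (x ** d x) ** b) = (\<Sum>b\<in>D. b ** (x ** (x ** d x)) ** b)"
      by (simp add: matrix_mul_assoc hx)
    also have "\<dots> = (\<Sum>b\<in>D. b ** (x ** d x ** x) ** b)"
      using trac[OF x(1), of "x ** d x"] by simp
    finally have t1: "(\<Sum>b\<in>D. b ** (x ** d x) ** b) = 0" by (simp add: xdx)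
    have "(\<Sum>b\<in>D. b ** d x ** b) = (\<Sum>b\<in>D. b ** (d x ** x) ** b) + (\<Sum>b\<in>D. b ** (x ** d x) ** b)"
      by (subst \<open>d x = d x ** x + x ** d x\<close>) (simp add: mmul_distribs sum.distrib)
    then have tau: "(\<Sum>b\<in>D. b ** d x ** b) = 0" using t1 trac[OF x(1), of "d x"] by simp
    \<comment> \<open>Multiply the Jordan identity for \<open>b x + x b\<close> by \<open>b\<close> and sum: moving \<open>x\<close> through the Casimir
      element cancels all terms except those in the claim.\<close>
    have "(\<Sum>b\<in>D. d (b ** x + x ** b) ** b)
        = (\<Sum>b\<in>D. (d b ** x + b ** d x + d x ** b + x ** d b) ** b)"
      using d_jordan x hx DB h by (intro sum.cong) auto
    also have "\<dots> = (\<Sum>b\<in>D. d b ** (x ** b)) + (\<Sum>b\<in>D. b ** d x ** b) + d x ** C + x ** T"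
      unfolding C_def T_def 
      by (simp add: mmul_distribs sum.distrib mmul_sum_right matrix_mul_assoc)
    finally have "(\<Sum>b\<in>D. d (b ** x) ** b) + (\<Sum>b\<in>D. d (x ** b) ** b)
      = (\<Sum>b\<in>D. d b ** (x ** b)) + d x ** C + x ** T"
      using tau by (simp add: clinear_mapD[OF d_lin] mmul_distribs sum.distrib)
    moreover have "(\<Sum>b\<in>D. d (b ** x) ** b) = (\<Sum>b\<in>D. d b ** (x ** b))"
      and "(\<Sum>b\<in>D. d (x ** b) ** b) = (\<Sum>b\<in>D. d b ** (b ** x))"
      using casimir_move[OF B D _ _ x(1), of "\<lambda>X Y. d X ** Y"]
        clinear_map_compose[OF clinear_mmul(2) d_lin] by (simp_all add: clinear_mmul)
    moreover have "(\<Sum>b\<in>D. d b ** (b ** x)) = T ** x"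
      unfolding T_def by (simp add: mmul_sum_left matrix_mul_assoc)
    ultimately show ?thesis by (simp add: algebra_simps)
  qed
  obtain Z where Z: "C ** Z = mat 1" "\<And>x. x \<in> B \<Longrightarrow> Z ** x = x ** Z"
    using casimir_invertible[OF B D] unfolding C_def by blast
  \<comment> \<open>On projections this is \<open>key\<close> multiplied by the central inverse
    \<open>Z\<close> of \<open>C\<close>; linearity covers the rest of \<open>B\<close>.\<close>
  have "d x = (T ** Z) ** x - x ** (T ** Z)" if x: "x \<in> B" for x
  proof (rule clinear_eq_on_projections[OF B d_lin _ _ x])
    show "clinear_map (\<lambda>x. (T ** Z) ** x - x ** (T ** Z))"
      by (simp add: clinear_map_def mmul_distribs csmult_diff)
    fix P assume P: "P \<in> B" "projection P"
    have "d P = d P ** (C ** Z)" by (simp add: Z)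
    also have "\<dots> = (T ** P - P ** T) ** Z"
      using key[OF P] by (simp add: matrix_mul_assoc mmul_distribs)
    also have "\<dots> = (T ** Z) ** P - P ** (T ** Z)"
      using Z(2)[OF P(1)] by (simp add: mmul_distribs) (simp flip: matrix_mul_assoc)
    finally show "d P = (T ** Z) ** P - P ** (T ** Z)" .
  qed
  then have "\<omega> Y X = trace (Y ** ((T ** Z) ** X - X ** (T ** Z)))" if "X \<in> B" "Y \<in> B" for X Y
    using d[OF that(2), of X] that(1) by simp
  then show ?thesis by (rule that)
qed

section \<open>From constancy on unitaries to a functional calculus for the form\<close>

lemma projection_complement: "projection P \<Longrightarrow> projection (mat 1 - P)"
  by (simp add: projection_def mmul_distribs cadj_diff)

text \<open>Test on the unitaries \<open>csmult z P + csmult w Q + (mat 1 - P - Q)\<close> with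
  \<open>z\<close> and \<open>w\<close> of modulus 1. The value is a Laurent polynomial in
  \<open>z\<close> and \<open>w\<close>, and its constancy kills the coefficient of
  \<open>cnj z * w\<close>, which is \<open>\<beta> P Q\<close>.\<close>

lemma form_orthogonal_projections:
  assumes B: "unital_cstar_subalgebra B" and \<beta>: "cbilinear_form \<beta>"
    and const: "\<And>U. U \<in> B \<Longrightarrow> unitary U \<Longrightarrow> \<beta> (cadj U) U = c"
    and P: "P \<in> B" "projection P" and Q: "Q \<in> B" "projection Q" and PQ: "P ** Q = 0"
  shows "\<beta> P Q = 0"
proof -
  note cl = subalgebra_intros[OF B]
  note bl = cbilinear_formD[OF \<beta>] cbilinear_form_simps[OF \<beta>]
  have hP: "cadj P = P" "P ** P = P" and hQ: "cadj Q = Q" "Q ** Q = Q"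
    using P Q by (auto simp: projection_def)
  have QP: "Q ** P = 0" using arg_cong[OF PQ, of cadj] hP hQ by (simp add: cadj_mmul)
  have comb: "\<beta> (csmult (cnj z) P + csmult (cnj w) Q + (mat 1 - P - Q))
      (csmult z P + csmult w Q + (mat 1 - P - Q)) = c" if "z * cnj z = 1" "w * cnj w = 1" for z w
  proof -
    define U where "U = csmult z P + csmult w Q + (mat 1 - P - Q)"
    have U: "cadj U = csmult (cnj z) P + csmult (cnj w) Q + (mat 1 - P - Q)"
      unfolding U_def by (simp add: cadj_add cadj_diff hP hQ)
    have "U \<in> B" unfolding U_def using P Q cl by auto
    moreover have "unitary U" unfolding unitary_def U unfolding U_def using that
      by (simp add: mmul_distribs hP hQ PQ QP csmult_diff mult.commute)
    ultimately show ?thesis using const U unfolding U_def by metis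
  qed
  define R where "R = mat 1 - P - Q"
  have "\<beta> P P + \<beta> Q Q + \<beta> R R + cnj z * w * \<beta> P Q + cnj w * z * \<beta> Q P
      + cnj z * \<beta> P R + z * \<beta> R P + cnj w * \<beta> Q R + w * \<beta> R Q = c"
    if "z * cnj z = 1" "w * cnj w = 1" for z w
  proof -
    have "\<beta> (csmult (cnj z) P + csmult (cnj w) Q + R) (csmult z P + csmult w Q + R)
      = (z * cnj z) * \<beta> P P + (w * cnj w) * \<beta> Q Q + \<beta> R R + cnj z * w * \<beta> P Q + cnj w * z * \<beta> Q P
      + cnj z * \<beta> P R + z * \<beta> R P + cnj w * \<beta> Q R + w * \<beta> R Q"
      by (simp add: bl algebra_simps)
    then show ?thesis using comb[OF that] that by (simp add: R_def)
  qed
  note eqs = this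
  \<comment> \<open>Six sample points suffice: the four sign choices give \<open>x + y = 0\<close>,
    and \<open>z = \<i>\<close> with \<open>w = 1\<close> and \<open>w = -1\<close> then yields
    \<open>x - y = 0\<close>.\<close>
  have solve: "x = 0" if "s + x + y + a + b + u + v = c" "s - x - y + a + b - u - v = c"
    "s - x - y - a - b + u + v = c" "s + x + y - a - b - u - v = c"
    "s - \<i> * x + \<i> * y - \<i> * a + \<i> * b + u + v = c" "s + \<i> * x - \<i> * y - \<i> * a + \<i> * b - u - v = c"
    for s x y a b u v :: complex
  proof -
    have "4 * (x + y) = (s + x + y + a + b + u + v) - (s - x - y + a + b - u - v)
        + (s + x + y - a - b - u - v) - (s - x - y - a - b + u + v)" by simp
    also have "\<dots> = 0" unfolding that by simp
    finally have "x + y = 0" by (simp only: mult_eq_0_iff) simp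
    have "2 * \<i> * (x - y) + (x + y) = (s + \<i> * x - \<i> * y - \<i> * a + \<i> * b - u - v)
        - (s - \<i> * x + \<i> * y - \<i> * a + \<i> * b + u + v)
        + (s + x + y + a + b + u + v) - (s - x - y + a + b - u - v) - (x + y)"
      by (simp add: algebra_simps)
    also have "\<dots> = 0" unfolding that \<open>x + y = 0\<close> by simp
    finally have "x - y = 0" using \<open>x + y = 0\<close> by simp
    then show ?thesis using \<open>x + y = 0\<close> by simp
  qed
  show ?thesis
    using eqs[of 1 1] eqs[of 1 "-1"] eqs[of "-1" 1] eqs[of "-1" "-1"] eqs[of "\<i>" 1] eqs[of "\<i>" "-1"]
    by (intro solve[where s = "\<beta> P P + \<beta> Q Q + \<beta> R R" and x = "\<beta> P Q" and y = "\<beta> Q P"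
          and a = "\<beta> P R" and b = "\<beta> R P" and u = "\<beta> Q R" and v = "\<beta> R Q"]) simp_all
qed

lemma orthogonal_combination_mmul:
  assumes "finite Q" "\<And>P. P \<in> Q \<Longrightarrow> projection P"
    and orth: "\<And>P P'. P \<in> Q \<Longrightarrow> P' \<in> Q \<Longrightarrow> P \<noteq> P' \<Longrightarrow> P ** P' = 0"
  shows "(\<Sum>P\<in>Q. f P *\<^sub>R P) ** (\<Sum>P\<in>Q. g P *\<^sub>R P) = (\<Sum>P\<in>Q. (f P * g P) *\<^sub>R P)"
proof -
  have "(\<Sum>P\<in>Q. f P *\<^sub>R P) ** (\<Sum>P\<in>Q. g P *\<^sub>R P)
      = (\<Sum>P\<in>Q. \<Sum>P'\<in>Q. (f P * g P') *\<^sub>R (P ** P'))"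
    unfolding mmul_sum_left unfolding mmul_sum_right by (simp add: mult.commute)
  also have "\<dots> = (\<Sum>P\<in>Q. \<Sum>P'\<in>Q. if P' = P then (f P * g P) *\<^sub>R P else 0)"
    using assms(2) orth by (intro sum.cong) (auto simp: projection_def)
  finally show ?thesis using assms(1) by simp
qed

text \<open>Distinct spectral projections of \<open>K\<close> are orthogonal for
  \<open>\<beta>\<close>, so on real functions of \<open>K\<close> the form depends only on the
  product of its arguments.\<close>

lemma form_functional_calculus:
  fixes \<beta> :: "'n::finite cmat \<Rightarrow> 'n cmat \<Rightarrow> complex"
  assumes B: "unital_cstar_subalgebra B" and \<beta>: "cbilinear_form \<beta>"
    and const: "\<And>U. U \<in> B \<Longrightarrow> unitary U \<Longrightarrow> \<beta> (cadj U) U = c"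
    and K: "K \<in> B" "cadj K = K"
  shows "\<beta> K K = \<beta> (mat 1) (K ** K)" "\<beta> K (K ** K) = \<beta> (mat 1) (K ** (K ** K))"
proof -
  note cl = subalgebra_intros[OF B]
  note bl = cbilinear_formD[OF \<beta>] cbilinear_form_simps[OF \<beta>]
  obtain Q and l :: "'n cmat \<Rightarrow> real" where Q: "finite Q" "Q \<subseteq> B"
      "\<And>P. P \<in> Q \<Longrightarrow> projection P" "\<And>P. P \<in> Q \<Longrightarrow> P \<noteq> 0"
      "\<And>P P'. P \<in> Q \<Longrightarrow> P' \<in> Q \<Longrightarrow> P \<noteq> P' \<Longrightarrow> P ** P' = 0"
      "K = (\<Sum>P\<in>Q. l P *\<^sub>R P)"
    by (rule spectral_decomposition[OF B K]) blast
  have orth: "\<beta> P P' = (if P' = P then \<beta> (mat 1) P else 0)" if P: "P \<in> Q" "P' \<in> Q" for P P'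
  proof (cases "P' = P")
    case True
    have PB: "P \<in> B" "projection P" using Q P by auto
    \<comment> \<open>Orthogonality of \<open>P\<close> to its complement evaluates the diagonal:
      \<open>\<beta> P P = \<beta> (mat 1) P\<close>.\<close>
    have "\<beta> (mat 1 - P) P = 0"
      using form_orthogonal_projections[OF B \<beta> const _ projection_complement PB(1,2)] PB cl
      by (simp add: projection_def mmul_distribs)
    then show ?thesis using True by (simp add: bl)
  next
    case False
    have "\<beta> P P' = 0"
      using Q P False by (intro form_orthogonal_projections[OF B \<beta> const]) auto
    then show ?thesis using False by simp
  qed
  note prod = orthogonal_combination_mmul[OF Q(1,3,5)]
  have form: "\<beta> (\<Sum>P\<in>Q. f P *\<^sub>R P) (\<Sum>P\<in>Q. g P *\<^sub>R P)
      = \<beta> (mat 1) ((\<Sum>P\<in>Q. f P *\<^sub>R P) ** (\<Sum>P\<in>Q. g P *\<^sub>R P))" for f g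
  proof -
    have "\<beta> (\<Sum>P\<in>Q. f P *\<^sub>R P) (\<Sum>P\<in>Q. g P *\<^sub>R P)
        = (\<Sum>P\<in>Q. \<Sum>P'\<in>Q. of_real (f P) * of_real (g P') * \<beta> P P')"
      unfolding cbilinear_form_simps(9)[OF \<beta>] unfolding cbilinear_form_simps(10)[OF \<beta>]
      by (simp add: bl mult_ac)
    also have "\<dots> = (\<Sum>P\<in>Q. \<Sum>P'\<in>Q. if P' = P then of_real (f P) * of_real (g P) * \<beta> (mat 1) P else 0)"
      using orth by (intro sum.cong) auto
    also have "\<dots> = \<beta> (mat 1) (\<Sum>P\<in>Q. (f P * g P) *\<^sub>R P)"
      using Q(1) by (simp add: bl)
    finally show ?thesis by (simp add: prod)
  qed
  show "\<beta> K K = \<beta> (mat 1) (K ** K)" "\<beta> K (K ** K) = \<beta> (mat 1) (K ** (K ** K))"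
    using form[of l l] form[of l "\<lambda>P. l P * l P"] by (simp_all add: Q(6) prod)
qed

text \<open>Split off the symmetric part of \<open>\<beta>\<close>. The remainder is a commutator
  form, whose sum is the trace of \<open>T\<close> against the difference of the two normalization
  sums and hence 0; the symmetric part sees their average \<open>mat 1\<close> and yields
  \<open>c\<close>.\<close>

lemma form_sum_doubly_normalized:
  assumes B: "unital_cstar_subalgebra B" and \<beta>: "cbilinear_form \<beta>"
    and const: "\<And>U. U \<in> B \<Longrightarrow> unitary U \<Longrightarrow> \<beta> (cadj U) U = c"
    and V: "\<And>j. j \<in> J \<Longrightarrow> V j \<in> B"
    and norm: "(\<Sum>j\<in>J. cadj (V j) ** V j) = mat 1" "(\<Sum>j\<in>J. V j ** cadj (V j)) = mat 1"
  shows "(\<Sum>j\<in>J. \<beta> (cadj (V j)) (V j)) = c"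
proof -
  note cl = subalgebra_intros[OF B]
  note bl = cbilinear_formD[OF \<beta>] cbilinear_form_simps[OF \<beta>]
  \<comment> \<open>The functional calculus makes \<open>\<omega>\<close> vanish at
    \<open>K, K\<close> and at \<open>K, K ** K\<close> for Hermitian \<open>K\<close>; polarizing
    the first gives antisymmetry, the second is the Jordan hypothesis.\<close>
  define \<omega> where "\<omega> X Y = \<beta> X Y - \<beta> (mat 1) (X ** Y + Y ** X) / 2" for X Y
  have \<omega>: "cbilinear_form \<omega>" unfolding cbilinear_form_def \<omega>_def
    by (simp add: bl mmul_distribs field_simps)
  note bl\<omega> = cbilinear_formD[OF \<omega>] cbilinear_form_simps[OF \<omega>]
  have diag: "\<omega> K K = 0" "\<omega> K (K ** K) = 0" if "K \<in> B" "cadj K = K" for K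
    using form_functional_calculus[OF B \<beta> const that]
    by (simp_all only: \<omega>_def bl matrix_mul_assoc) simp_all
  have anti_herm: "\<omega> K L = - \<omega> L K" if "K \<in> B" "cadj K = K" "L \<in> B" "cadj L = L" for K L
  proof -
    have "\<omega> (K + L) (K + L) = 0" using that cl by (intro diag) (auto simp: cadj_add)
    then show ?thesis using diag that by (simp add: bl\<omega> eq_neg_iff_add_eq_0 add.commute)
  qed
  have anti: "\<omega> X Y = - \<omega> Y X" if XY: "X \<in> B" "Y \<in> B" for X Y
  proof -
    obtain H K where X: "H \<in> B" "cadj H = H" "K \<in> B" "cadj K = K" "X = H + csmult \<i> K"
      using hermitian_parts[OF B XY(1)] by metis
    obtain H' K' where Y: "H' \<in> B" "cadj H' = H'" "K' \<in> B" "cadj K' = K'" "Y = H' + csmult \<i> K'"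
      using hermitian_parts[OF B XY(2)] by metis
    show ?thesis using X(1-4) Y(1-4) unfolding X(5) Y(5)
      by (simp add: bl\<omega> anti_herm[of H H'] anti_herm[of H K'] anti_herm[of K H'] anti_herm[of K K']
          algebra_simps)
  qed
  obtain T where T: "\<And>X Y. X \<in> B \<Longrightarrow> Y \<in> B \<Longrightarrow> \<omega> Y X = trace (Y ** (T ** X - X ** T))"
    by (rule antisymmetric_form_eq_commutator[OF B \<omega>], erule (1) anti, erule (1) diag(2), blast)
  have "(\<Sum>j\<in>J. \<omega> (cadj (V j)) (V j)) = (\<Sum>j\<in>J. trace (T ** (V j ** cadj (V j) - cadj (V j) ** V j)))"
  proof (rule sum.cong)
    fix j assume j: "j \<in> J"
    have "\<omega> (cadj (V j)) (V j) = trace (cadj (V j) ** (T ** V j)) - trace (cadj (V j) ** V j ** T)"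
      using T[of "V j" "cadj (V j)"] V[OF j] cl by (simp add: mmul_distribs trace_sub matrix_mul_assoc)
    also have "\<dots> = trace (T ** V j ** cadj (V j)) - trace (T ** (cadj (V j) ** V j))"
      using trace_mul_sym[of "cadj (V j)" "T ** V j"] trace_mul_sym[of "cadj (V j) ** V j" T] by simp
    finally show "\<omega> (cadj (V j)) (V j) = trace (T ** (V j ** cadj (V j) - cadj (V j) ** V j))"
      by (simp add: mmul_distribs trace_sub matrix_mul_assoc)
  qed simp
  also have "\<dots> = trace (T ** ((\<Sum>j\<in>J. V j ** cadj (V j)) - (\<Sum>j\<in>J. cadj (V j) ** V j)))"
    by (simp add: mmul_sum_right trace_sum flip: sum_subtractf)
  finally have 0: "(\<Sum>j\<in>J. \<omega> (cadj (V j)) (V j)) = 0" by (simp add: norm)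
  have "(\<Sum>j\<in>J. \<beta> (cadj (V j)) (V j)) = (\<Sum>j\<in>J. \<omega> (cadj (V j)) (V j))
      + \<beta> (mat 1) ((\<Sum>j\<in>J. cadj (V j) ** V j) + (\<Sum>j\<in>J. V j ** cadj (V j))) / 2"
    by (simp add: \<omega>_def bl sum.distrib sum_subtractf sum_divide_distrib add_divide_distrib)
  also have "\<dots> = \<beta> (mat 1) (mat 1)" unfolding 0 norm bl by simp
  also have "\<dots> = c" using const[of "mat 1"] cl by (simp add: unitary_def)
  finally show ?thesis .
qed

section \<open>Kraus operators\<close>

text \<open>The spectral decomposition in the full matrix algebra has nonnegative coefficients, so
  \<open>Q\<close> can be the positive square root of \<open>C\<close>.\<close>

lemma psd_factorization:
  fixes C :: "'m::finite cmat"
  assumes psd: "\<And>y. \<exists>r\<ge>0. (\<Sum>p\<in>UNIV. cnj (y $ p) * (C *v y) $ p) = complex_of_real r"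
  obtains Q where "C = Q ** cadj Q"
proof -
  define f where "f x y = (\<Sum>p\<in>UNIV. cnj (x $ p) * (C *v y) $ p)" for x y
  have f_add: "f (x + x') y = f x y + f x' y" "f x (y + y') = f x y + f x y'" for x x' y y'
    by (simp_all add: f_def matrix_vector_right_distrib algebra_simps sum.distrib)
  have f_scale: "f (c *s x) y = cnj c * f x y" "f x (c *s y) = c * f x y" for c x y
    by (simp_all add: f_def matrix_vector_mult_def sum_distrib_left mult_ac)
  have f_real: "Im (f x x) = 0" for x using psd[of x] unfolding f_def by (metis Im_complex_of_real)
  \<comment> \<open>Polarization: the form is real at \<open>x + y\<close> and at
    \<open>x + \<i> *s y\<close>, which forces it to be Hermitian.\<close>
  have sym: "f y x = cnj (f x y)" for x y
  proof -
    have "Im (f (x + y) (x + y)) = 0" "Im (f (x + \<i> *s y) (x + \<i> *s y)) = 0" using f_real by auto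
    then show ?thesis by (simp add: f_add f_scale f_real complex_eq_iff)
  qed
  have f_axis: "f (axis p 1) (axis q 1) = C $ p $ q" for p q
    by (simp add: f_def axis_def matrix_vector_mult_def if_distrib if_distribR cong: if_cong)
  have herm: "cadj C = C" unfolding vec_eq_iff
  proof (intro allI)
    fix p q
    show "cadj C $ p $ q = C $ p $ q" using sym[of "axis q 1" "axis p 1"]
      unfolding f_axis cadj_def by simp
  qed
  have alg: "unital_cstar_subalgebra (UNIV :: 'm cmat set)" by (simp add: unital_cstar_subalgebra_def)
  obtain S and l :: "'m cmat \<Rightarrow> real" where S: "finite S" "S \<subseteq> UNIV"
      "\<And>P. P \<in> S \<Longrightarrow> projection P" "\<And>P. P \<in> S \<Longrightarrow> P \<noteq> 0"
      "\<And>P P'. P \<in> S \<Longrightarrow> P' \<in> S \<Longrightarrow> P \<noteq> P' \<Longrightarrow> P ** P' = 0"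
      "C = (\<Sum>P\<in>S. l P *\<^sub>R P)"
    by (rule spectral_decomposition[OF alg UNIV_I herm]) blast
  note prod = orthogonal_combination_mmul[OF S(1,3,5)]
  have pos: "l P \<ge> 0" if P: "P \<in> S" for P
  proof -
    have "C ** P = (\<Sum>P'\<in>S. l P' *\<^sub>R (P' ** P))" by (simp add: S(6) mmul_sum_left)
    also have "\<dots> = (\<Sum>P'\<in>S. if P' = P then l P *\<^sub>R P else 0)"
      using S(3,5) P by (intro sum.cong) (auto simp: projection_def)
    finally have CP: "C ** P = l P *\<^sub>R P" using S(1) P by simp
    obtain y where y: "P *v y \<noteq> 0" using S(4)[OF P] by (metis matrix_eq matrix_vector_mult_0)
    define x where "x = P *v y"
    have "C *v x = l P *\<^sub>R x" by (simp add: x_def matrix_vector_mul_assoc CP matrix_vector_scaleR)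
    then have "Re (f x x) = l P * (x \<bullet> x)"
      by (simp add: f_def inner_cvec sum_distrib_left algebra_simps)
    moreover have "Re (f x x) \<ge> 0" using psd[of x] unfolding f_def by (metis Re_complex_of_real)
    moreover have "x \<bullet> x > 0" using y by (simp add: x_def)
    ultimately show ?thesis by (simp add: zero_le_mult_iff)
  qed
  define Q where "Q = (\<Sum>P\<in>S. sqrt (l P) *\<^sub>R P)"
  have "cadj Q = Q" unfolding Q_def cadj_sum using S(3) by (intro sum.cong) (auto simp: projection_def)
  then have "Q ** cadj Q = (\<Sum>P\<in>S. (sqrt (l P) * sqrt (l P)) *\<^sub>R P)" using prod by (simp add: Q_def)
  also have "\<dots> = C" unfolding S(6) using pos by (intro sum.cong) auto
  finally show ?thesis using that by metis
qed

section \<open>Matrix units and Kraus operators from the Choi matrix\<close>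

definition unit_mat :: "'n::finite \<Rightarrow> 'n \<Rightarrow> 'n cmat" where
  "unit_mat a b = (\<chi> i j. if i = a \<and> j = b then 1 else 0)"

lemma unit_mat_expansion: "X = (\<Sum>a\<in>UNIV. \<Sum>b\<in>UNIV. csmult (X $ a $ b) (unit_mat a b))"
proof -
  have "(\<Sum>a\<in>UNIV. \<Sum>b\<in>UNIV. if i = a \<and> j = b then X $ a $ b else 0) = X $ i $ j" for i j
  proof -
    have "(\<Sum>a\<in>UNIV. \<Sum>b\<in>UNIV. if i = a \<and> j = b then X $ a $ b else 0)
      = (\<Sum>a\<in>UNIV. if a = i then (\<Sum>b\<in>UNIV. if b = j then X $ a $ b else 0) else 0)"
      by (intro sum.cong) (auto intro: sum.cong)
    then show ?thesis by simp
  qed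
  then show ?thesis by (simp add: vec_eq_iff csmult_def unit_mat_def if_distrib cong: if_cong)
qed

lemma clinear_unit_mat:
  assumes "clinear_map F"
  shows "F X = (\<Sum>a\<in>UNIV. \<Sum>b\<in>UNIV. csmult (X $ a $ b) (F (unit_mat a b)))"
  by (subst unit_mat_expansion[of X]) (simp add: clinear_map_sum[OF assms] clinear_mapD[OF assms])

lemma unit_mat_mult_vec: "(unit_mat a b *v x) $ c = (if c = a then x $ b else 0)"
  by (simp add: unit_mat_def matrix_vector_mult_def if_distrib if_distribR cong: if_cong)

text \<open>Choi's theorem: the matrix units form a positive block matrix, so their images do as well.\<close>

lemma kraus_decomposition:
  fixes F :: "'n::finite cmat \<Rightarrow> 'n cmat"
  assumes F: "completely_positive F"
  obtains V :: "'n \<times> 'n \<Rightarrow> 'n cmat" where "\<And>X. F X = (\<Sum>k\<in>UNIV. Ad (V k) X)"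
proof -
  define k where "k = CARD('n)"
  \<comment> \<open>\<open>block_psd\<close> numbers its blocks by naturals, so the index type has
    to be enumerated.\<close>
  obtain g where g: "bij_betw g {..<k} (UNIV :: 'n set)"
    using ex_bij_betw_nat_finite[of "UNIV :: 'n set"] by (auto simp: k_def atLeast0LessThan)
  have "block_psd k (\<lambda>i j. unit_mat (g i) (g j))"
    unfolding block_psd_def
  proof (intro allI)
    fix x :: "nat \<Rightarrow> complex^'n"
    define s where "s = (\<Sum>j<k. x j $ g j)"
    have "(\<Sum>i<k. \<Sum>j<k. \<Sum>a\<in>UNIV. cnj (x i $ a) * ((unit_mat (g i) (g j) *v x j) $ a)) = cnj s * s"
      by (simp add: unit_mat_mult_vec if_distrib s_def sum_product cong: if_cong)
    also have "\<dots> = complex_of_real ((cmod s)\<^sup>2)" by (simp only: complex_norm_square mult.commute)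
    finally show "\<exists>r\<ge>0. (\<Sum>i<k. \<Sum>j<k. \<Sum>a\<in>UNIV.
        cnj (x i $ a) * ((unit_mat (g i) (g j) *v x j) $ a)) = complex_of_real r"
      by (intro exI[of _ "(cmod s)\<^sup>2"]) simp
  qed
  then have psd: "block_psd k (\<lambda>i j. F (unit_mat (g i) (g j)))"
    using F unfolding completely_positive_def by blast
  \<comment> \<open>The Choi matrix: the first components of the indices choose the matrix unit, the
    second ones an entry of its image.\<close>
  define C :: "('n \<times> 'n) cmat" where "C = (\<chi> p q. F (unit_mat (fst p) (fst q)) $ snd p $ snd q)"
  have pairs: "(\<Sum>p\<in>UNIV. h p) = (\<Sum>i\<in>UNIV. \<Sum>a\<in>UNIV. h (i, a))" for h :: "'n \<times> 'n \<Rightarrow> complex"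
    by (simp add: sum.cartesian_product)
  have "\<exists>r\<ge>0. (\<Sum>p\<in>UNIV. cnj (y $ p) * (C *v y) $ p) = complex_of_real r" for y
  proof -
    define x where "x i = (\<chi> a. y $ (g i, a))" for i
    have "(\<Sum>p\<in>UNIV. cnj (y $ p) * (C *v y) $ p)
        = (\<Sum>i\<in>UNIV. \<Sum>a\<in>UNIV. cnj (y $ (i, a)) * (\<Sum>j\<in>UNIV. \<Sum>b\<in>UNIV. F (unit_mat i j) $ a $ b * y $ (j, b)))"
      by (simp add: matrix_vector_mult_def pairs C_def)
    also have "\<dots> = (\<Sum>i\<in>UNIV. \<Sum>a\<in>UNIV. \<Sum>j\<in>UNIV. cnj (y $ (i, a)) * (F (unit_mat i j) *v (\<chi> b. y $ (j, b))) $ a)"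
      by (simp add: matrix_vector_mult_def sum_distrib_left)
    also have "\<dots> = (\<Sum>i\<in>UNIV. \<Sum>j\<in>UNIV. \<Sum>a\<in>UNIV. cnj (y $ (i, a)) * (F (unit_mat i j) *v (\<chi> b. y $ (j, b))) $ a)"
      by (rule sum.cong[OF refl sum.swap])
    also have "\<dots> = (\<Sum>i<k. \<Sum>j<k. \<Sum>a\<in>UNIV. cnj (x i $ a) * (F (unit_mat (g i) (g j)) *v x j) $ a)"
      unfolding x_def by (simp flip: sum.reindex_bij_betw[OF g])
    finally show ?thesis using psd unfolding block_psd_def by metis
  qed
  then obtain Q where Q: "C = Q ** cadj Q" using psd_factorization[of C] by blast
  \<comment> \<open>Column \<open>k\<close> of \<open>Q\<close> reshaped into a matrix, with a
    conjugation because \<open>Ad\<close> carries the adjoint on the left.\<close>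
  define V where "V k = (\<chi> i a. cnj (Q $ (i, a) $ k))" for k
  have "F X = (\<Sum>k\<in>UNIV. Ad (V k) X)" for X
  proof -
    have "F X $ a $ b = (\<Sum>k\<in>UNIV. Ad (V k) X) $ a $ b" for a b
    proof -
      have "F X $ a $ b = (\<Sum>i\<in>UNIV. \<Sum>j\<in>UNIV. X $ i $ j * C $ (i, a) $ (j, b))"
        using F by (subst clinear_unit_mat) (auto simp: completely_positive_def C_def csmult_def)
      also have "\<dots> = (\<Sum>i\<in>UNIV. \<Sum>j\<in>UNIV. \<Sum>k\<in>UNIV. X $ i $ j * (Q $ (i, a) $ k * cnj (Q $ (j, b) $ k)))"
        by (simp add: Q matrix_matrix_mult_def cadj_def sum_distrib_left)
      also have "\<dots> = (\<Sum>i\<in>UNIV. \<Sum>k\<in>UNIV. \<Sum>j\<in>UNIV. X $ i $ j * (Q $ (i, a) $ k * cnj (Q $ (j, b) $ k)))"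
        by (intro sum.cong refl sum.swap)
      also have "\<dots> = (\<Sum>k\<in>UNIV. \<Sum>i\<in>UNIV. \<Sum>j\<in>UNIV. X $ i $ j * (Q $ (i, a) $ k * cnj (Q $ (j, b) $ k)))"
        by (rule sum.swap)
      also have "\<dots> = (\<Sum>k\<in>UNIV. \<Sum>j\<in>UNIV. \<Sum>i\<in>UNIV. X $ i $ j * (Q $ (i, a) $ k * cnj (Q $ (j, b) $ k)))"
        by (intro sum.cong refl sum.swap)
      also have "\<dots> = (\<Sum>k\<in>UNIV. Ad (V k) X) $ a $ b"
        by (simp add: Ad_def V_def matrix_matrix_mult_def cadj_def sum_distrib_left mult_ac)
      finally show ?thesis .
    qed
    then show ?thesis by (simp add: vec_eq_iff)
  qed
  then show ?thesis by (rule that)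
qed

section \<open>The commutant and the Kraus operators of channels fixing the subalgebra\<close>

definition commutant :: "'n::finite cmat set \<Rightarrow> 'n cmat set" where
  "commutant S = {X. \<forall>A\<in>S. X ** A = A ** X}"

lemma commutant_subalgebra:
  assumes S: "unital_cstar_subalgebra S"
  shows "unital_cstar_subalgebra (commutant S)"
  unfolding unital_cstar_subalgebra_def
proof (intro conjI ballI allI)
  show "mat 1 \<in> commutant S" by (simp add: commutant_def)
  fix A B assume A: "A \<in> commutant S"
  show "csmult c A \<in> commutant S" for c using A by (simp add: commutant_def)
  show "cadj A \<in> commutant S" unfolding commutant_def
  proof (intro CollectI ballI)
    fix X assume "X \<in> S"
    then have "A ** cadj X = cadj X ** A" using A subalgebra_closed(5)[OF S] by (simp add: commutant_def)
    from arg_cong[OF this, of cadj] show "cadj A ** X = X ** cadj A" by (simp add: cadj_mmul)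
  qed
  assume B: "B \<in> commutant S"
  show "A + B \<in> commutant S" using A B by (simp add: commutant_def mmul_distribs)
  show "A ** B \<in> commutant S" unfolding commutant_def
  proof (intro CollectI ballI)
    fix X assume X: "X \<in> S"
    have "A ** B ** X = A ** (X ** B)" using B X by (simp add: commutant_def flip: matrix_mul_assoc)
    also have "\<dots> = X ** (A ** B)" using A X by (simp add: commutant_def matrix_mul_assoc)
    finally show "A ** B ** X = X ** (A ** B)" .
  qed
qed

text \<open>For \<open>A\<close> in \<open>S\<close>, the squares of the commutators of the
  \<open>V k\<close> with \<open>A\<close> add up to an expression in \<open>F A\<close>,
  \<open>F (cadj A)\<close> and \<open>F (cadj A ** A)\<close>. It vanishes because \<open>F\<close>
  fixes these arguments, so each commutator is 0.\<close>

lemma fixing_channel_kraus: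
  assumes S: "unital_cstar_subalgebra S" and F: "F \<in> fixing_channels S"
  obtains V :: "'n \<times> 'n \<Rightarrow> 'n::finite cmat" where
    "\<And>X. F X = (\<Sum>k\<in>UNIV. Ad (V k) X)" "\<And>k. V k \<in> commutant S"
    "(\<Sum>k\<in>UNIV. cadj (V k) ** V k) = mat 1" "(\<Sum>k\<in>UNIV. V k ** cadj (V k)) = mat 1"
proof -
  have cp: "completely_positive F" and unital: "F (mat 1) = mat 1"
    and tp: "\<And>X. trace (F X) = trace X" and fixes_S: "\<And>A. A \<in> S \<Longrightarrow> F A = A"
    using F by (auto simp: fixing_channels_def unital_channel_def)
  obtain V :: "'n \<times> 'n \<Rightarrow> 'n cmat" where V: "\<And>X. F X = (\<Sum>k\<in>UNIV. Ad (V k) X)"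
    using kraus_decomposition[OF cp] by blast
  have one: "(\<Sum>k\<in>UNIV. cadj (V k) ** V k) = mat 1"
    using unital by (simp add: V Ad_def)
  have comm: "V k \<in> commutant S" for k unfolding commutant_def
  proof (intro CollectI ballI)
    fix A assume A: "A \<in> S"
    have A': "cadj A \<in> S" "cadj A ** A \<in> S" using A subalgebra_closed[OF S] by auto
    have "(\<Sum>k\<in>UNIV. cadj (V k ** A - A ** V k) ** (V k ** A - A ** V k))
        = cadj A ** (\<Sum>k\<in>UNIV. cadj (V k) ** V k) ** A - cadj A ** F A - F (cadj A) ** A + F (cadj A ** A)"
      unfolding V mmul_sum_left mmul_sum_right
      by (simp add: Ad_def cadj_diff cadj_mmul mmul_distribs matrix_mul_assoc sum.distrib sum_subtractf)
    also have "\<dots> = 0" using A A' fixes_S one by simp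
    finally have "V k ** A - A ** V k = 0"
      using sum_cadj_mmul_eq_zero[of UNIV "\<lambda>k. V k ** A - A ** V k" k] by simp
    then show "V k ** A = A ** V k" by simp
  qed
  \<comment> \<open>Trace preservation makes \<open>W\<close> orthogonal to every matrix, in
    particular to itself.\<close>
  define W where "W = (\<Sum>k\<in>UNIV. V k ** cadj (V k)) - mat 1"
  have "trace (X ** W) = 0" for X
  proof -
    have "trace X = (\<Sum>k\<in>UNIV. trace (cadj (V k) ** (X ** V k)))"
      using tp[of X] by (simp add: V Ad_def trace_sum matrix_mul_assoc)
    also have "\<dots> = (\<Sum>k\<in>UNIV. trace (X ** (V k ** cadj (V k))))"
      by (intro sum.cong refl, subst trace_mul_sym) (simp only: matrix_mul_assoc)
    finally show ?thesis by (simp add: W_def mmul_distribs trace_sub mmul_sum_right trace_sum)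
  qed
  then have "trace (cadj W ** W) = 0" by blast
  then have "W = 0" by (simp add: trace_cadj_mmul_self)
  then have two: "(\<Sum>k\<in>UNIV. V k ** cadj (V k)) = mat 1" by (simp add: W_def)
  show ?thesis by (rule that[OF V comm one two])
qed

section \<open>Channels as points of a Euclidean space\<close>

text \<open>The blocks of the Choi matrix, kept as a point of a Euclidean space, where convex hulls
  and relative interiors are available; \<open>choi_map\<close> is the inverse on linear
  maps.\<close>

definition choi :: "('n::finite cmat \<Rightarrow> 'n cmat) \<Rightarrow> 'n cmat^'n^'n" where
  "choi F = (\<chi> a b. F (unit_mat a b))"

definition choi_map :: "'n::finite cmat^'n^'n \<Rightarrow> 'n cmat \<Rightarrow> 'n cmat" where
  "choi_map M X = (\<Sum>a\<in>UNIV. \<Sum>b\<in>UNIV. csmult (X $ a $ b) (M $ a $ b))"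

lemma choi_map_choi:
  assumes "clinear_map F"
  shows "choi_map (choi F) = F"
proof
  fix X
  show "choi_map (choi F) X = F X"
    by (subst clinear_unit_mat[OF assms, of X]) (simp add: choi_map_def choi_def)
qed

lemma clinear_choi_map: "clinear_map (choi_map M)"
  unfolding clinear_map_def choi_map_def
  by (simp add: csmult_def vec_eq_iff sum.distrib sum_distrib_left algebra_simps)

lemma choi_choi_map: "choi (choi_map M) = M"
proof -
  have "csmult (unit_mat a b $ a' $ b') (M $ a' $ b') = (if b' = b then if a' = a then M $ a $ b else 0 else 0)"
    for a b a' b' by (simp add: unit_mat_def)
  then have "choi_map M (unit_mat a b) = M $ a $ b" for a b
    by (simp add: choi_map_def)
  then show ?thesis by (simp add: choi_def vec_eq_iff)
qed

lemma choi_map_linear: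
  "choi_map (M + M') X = choi_map M X + choi_map M' X"
  "choi_map (r *\<^sub>R M) X = r *\<^sub>R choi_map M X"
proof -
  show "choi_map (M + M') X = choi_map M X + choi_map M' X"
    by (simp add: choi_map_def csmult_add sum.distrib)
  have "csmult c (r *\<^sub>R A) = r *\<^sub>R csmult c A" for c and A :: "'a cmat"
    by (simp add: mult.commute flip: csmult_of_real)
  then show "choi_map (r *\<^sub>R M) X = r *\<^sub>R choi_map M X"
    by (simp add: choi_map_def scaleR_sum_right)
qed

lemma choi_map_sum: "choi_map (\<Sum>i\<in>I. u i *\<^sub>R f i) X = (\<Sum>i\<in>I. u i *\<^sub>R choi_map (f i) X)"
proof -
  have "linear (\<lambda>M. choi_map M X)" by (rule linearI) (simp_all add: choi_map_linear)
  from linear_sum[OF this, of "\<lambda>i. u i *\<^sub>R f i" I] show ?thesis by (simp add: choi_map_linear)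
qed

text \<open>Transported to the Euclidean space, \<open>N\<close> is convex and therefore continuous;
  its minimum on the unit sphere is positive and serves as \<open>m\<close>.\<close>

lemma map_norm_dominates:
  fixes N :: "('n::finite cmat \<Rightarrow> 'n cmat) \<Rightarrow> real"
  assumes N: "is_map_norm N"
  obtains m where "m > 0" "\<And>F. clinear_map F \<Longrightarrow> m * norm (choi F) \<le> N F"
proof -
  define n where "n M = N (choi_map M)" for M
  note lin = clinear_choi_map
  have N_pos: "N F \<ge> 0" "N F = 0 \<longleftrightarrow> F = (\<lambda>_. 0)" if "clinear_map F" for F
    using N that unfolding is_map_norm_def by blast+
  have N_add: "N (\<lambda>X. F X + G X) \<le> N F + N G" if "clinear_map F" "clinear_map G" for F G
    using N that unfolding is_map_norm_def by blast
  have N_scale: "N (\<lambda>X. csmult c (F X)) = cmod c * N F" if "clinear_map F" for F c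
    using N that unfolding is_map_norm_def by blast
  have n_add: "n (x + y) \<le> n x + n y" for x y
  proof -
    have "choi_map (x + y) = (\<lambda>X. choi_map x X + choi_map y X)" by (rule ext) (rule choi_map_linear)
    then show ?thesis using N_add[OF lin lin] by (simp add: n_def)
  qed
  have n_scale: "n (r *\<^sub>R x) = \<bar>r\<bar> * n x" for r x
  proof -
    have "choi_map (r *\<^sub>R x) = (\<lambda>X. csmult (of_real r) (choi_map x X))"
      by (rule ext) (simp add: choi_map_linear csmult_of_real)
    then show ?thesis using N_scale[OF lin, of "of_real r"] by (simp add: n_def)
  qed
  have "convex_on UNIV n"
  proof (rule convex_onI)
    fix t :: real and x y assume "t > 0" "t < 1"
    then show "n ((1 - t) *\<^sub>R x + t *\<^sub>R y) \<le> (1 - t) * n x + t * n y"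
      using n_add[of "(1 - t) *\<^sub>R x" "t *\<^sub>R y"] by (simp add: n_scale)
  qed simp
  then have "continuous_on UNIV n" by (intro convex_on_continuous) auto
  then have cont: "continuous_on (sphere 0 1) n" by (rule continuous_on_subset) simp
  have ne: "sphere (0 :: 'n cmat^'n^'n) 1 \<noteq> {}" by simp
  obtain x0 where x0: "x0 \<in> sphere 0 1" "\<And>y. y \<in> sphere 0 1 \<Longrightarrow> n x0 \<le> n y"
    using continuous_attains_inf[OF compact_sphere ne cont] by blast
  have pos: "n x0 > 0"
  proof -
    have "n x0 \<noteq> 0"
    proof
      assume "n x0 = 0"
      then have "choi_map x0 = (\<lambda>_. 0)" using N_pos(2)[OF lin] by (simp add: n_def)
      then have "x0 = 0" using choi_choi_map[of x0] by (simp add: choi_def vec_eq_iff)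
      then show False using x0(1) by simp
    qed
    then show ?thesis using N_pos(1)[OF lin, of x0] by (simp add: n_def)
  qed
  have bound: "n x0 * norm x \<le> n x" for x
  proof (cases "x = 0")
    case False
    have "n x0 \<le> n ((1 / norm x) *\<^sub>R x)" using False by (intro x0(2)) simp
    then show ?thesis using False by (simp add: n_scale field_simps)
  next
    case True
    then show ?thesis using n_scale[of 0 x] by simp
  qed
  show ?thesis
  proof (rule that[OF pos])
    fix F :: "'n cmat \<Rightarrow> 'n cmat" assume "clinear_map F"
    then show "n x0 * norm (choi F) \<le> N F"
      using bound[of "choi F"] by (simp add: n_def choi_map_choi)
  qed
qed

section \<open>Conjugation by unitaries, and its isometric action on Choi points\<close>

lemma clinear_Ad: "clinear_map (Ad V)"
  by (simp add: clinear_map_def Ad_def mmul_distribs)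

lemma Ad_Ad: "Ad U (Ad V X) = Ad (V ** U) X"
  by (simp add: Ad_def cadj_mmul matrix_mul_assoc)

lemma norm_Ad:
  assumes "unitary U"
  shows "norm (Ad U X) = norm X"
proof -
  have U: "U ** cadj U = mat 1" using assms by (simp add: unitary_def)
  have "cadj (Ad U X) ** Ad U X = cadj U ** cadj X ** (U ** cadj U) ** X ** U"
    by (simp add: Ad_def cadj_mmul matrix_mul_assoc)
  also have "\<dots> = cadj U ** (cadj X ** X ** U)" by (simp add: U matrix_mul_assoc)
  finally have "trace (cadj (Ad U X) ** Ad U X) = trace (cadj U ** (cadj X ** X ** U))" by simp
  also have "\<dots> = trace (cadj X ** X ** (U ** cadj U))"
    by (subst trace_mul_sym) (simp only: matrix_mul_assoc)
  finally have "complex_of_real ((norm (Ad U X))\<^sup>2) = complex_of_real ((norm X)\<^sup>2)"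
    by (simp only: U matrix_mul_rid trace_cadj_mmul_self)
  then show ?thesis by (simp only: of_real_eq_iff) simp
qed

definition unitaries :: "'n::finite cmat set \<Rightarrow> 'n cmat set" where
  "unitaries B = {U \<in> B. unitary U}"

lemma unitaries_one: "unital_cstar_subalgebra B \<Longrightarrow> mat 1 \<in> unitaries B"
  by (simp add: unitaries_def unitary_def subalgebra_closed)

lemma unitaries_cadj: "unital_cstar_subalgebra B \<Longrightarrow> U \<in> unitaries B \<Longrightarrow> cadj U \<in> unitaries B"
  by (simp add: unitaries_def unitary_def subalgebra_closed)

lemma unitaries_mmul:
  assumes "unital_cstar_subalgebra B" "U \<in> unitaries B" "V \<in> unitaries B"
  shows "U ** V \<in> unitaries B"
proof -
  have U: "cadj U ** U = mat 1" "U ** cadj U = mat 1" and V: "cadj V ** V = mat 1" "V ** cadj V = mat 1"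
    using assms by (auto simp: unitaries_def unitary_def)
  have "cadj (U ** V) ** (U ** V) = cadj V ** (cadj U ** U) ** V"
    "(U ** V) ** cadj (U ** V) = U ** (V ** cadj V) ** cadj U"
    by (simp_all only: cadj_mmul matrix_mul_assoc)
  then show ?thesis using assms U V by (simp add: unitaries_def unitary_def subalgebra_closed)
qed

text \<open>Compactness makes the convex hull of an orbit closed, so that it contains a point of
  least norm.\<close>

lemma compact_unitaries:
  fixes B :: "'n::finite cmat set"
  assumes B: "unital_cstar_subalgebra B"
  shows "compact (unitaries B)"
proof -
  have eq: "unitaries B = B \<inter> {U. cadj U ** U = mat 1}"
    by (auto simp: unitaries_def unitary_def matrix_left_right_inverse)
  have "continuous_on UNIV (\<lambda>U :: 'n cmat. cadj U ** U)"
    unfolding cadj_def matrix_matrix_mult_def by (auto intro!: continuous_intros)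
  then have "closed {U :: 'n cmat. cadj U ** U = mat 1}"
    by (intro closed_Collect_eq continuous_intros)
  then have "closed (unitaries B)"
    unfolding eq using closed_subspace[OF subspace_subalgebra[OF B]] by (rule closed_Int[rotated])
  moreover have "norm U \<le> sqrt (real CARD('n))" if "U \<in> unitaries B" for U
  proof -
    have "complex_of_real ((norm U)\<^sup>2) = of_nat CARD('n)"
      using that trace_cadj_mmul_self[of U] by (simp add: eq trace_I)
    then have "(norm U)\<^sup>2 = real CARD('n)" by (metis of_real_eq_iff of_real_of_nat_eq)
    then show ?thesis by (simp add: real_le_rsqrt)
  qed
  then have "bounded (unitaries B)" unfolding bounded_iff by blast
  ultimately show ?thesis by (simp add: compact_eq_bounded_closed)
qed

text \<open>The action of \<open>U\<close> on linear maps by composing with \<open>Ad U\<close>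
  after the map, expressed on blocks.\<close>

definition choi_conj :: "'n::finite cmat \<Rightarrow> 'n cmat^'n^'n \<Rightarrow> 'n cmat^'n^'n" where
  "choi_conj U M = (\<chi> a b. Ad U (M $ a $ b))"

lemma linear_choi_conj: "linear (choi_conj U)"
  by (rule linearI) (simp_all add: choi_conj_def vec_eq_iff
      linear_add[OF clinear_map_linear[OF clinear_Ad]] linear_scale[OF clinear_map_linear[OF clinear_Ad]])

lemma norm_choi_conj:
  assumes "unitary U"
  shows "norm (choi_conj U M) = norm M"
proof -
  have "norm (choi_conj U M $ a) = norm (M $ a)" for a
    unfolding norm_vec_def[of "choi_conj U M $ a"] norm_vec_def[of "M $ a"]
    by (simp add: choi_conj_def norm_Ad[OF assms])
  then show ?thesis unfolding norm_vec_def[of "choi_conj U M"] norm_vec_def[of M] by simp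
qed

lemma choi_conj_choi: "choi_conj U (choi F) = choi (\<lambda>X. Ad U (F X))"
  by (simp add: choi_conj_def choi_def)

lemma choi_conj_choi_conj: "choi_conj U (choi_conj V M) = choi_conj (V ** U) M"
  by (simp add: choi_conj_def Ad_Ad)

lemma choi_map_choi_conj: "choi_map (choi_conj U M) X = Ad U (choi_map M X)"
  by (simp add: choi_map_def choi_conj_def clinear_map_sum[OF clinear_Ad] clinear_mapD[OF clinear_Ad])

lemma continuous_on_choi_conj: "continuous_on A (\<lambda>U. choi_conj U M)"
  unfolding choi_conj_def Ad_def cadj_def matrix_matrix_mult_def
  by (auto intro!: continuous_intros)

definition unitary_points :: "'n::finite cmat set \<Rightarrow> ('n cmat^'n^'n) set" where
  "unitary_points B = (\<lambda>U. choi (Ad U)) ` unitaries B"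

section \<open>The conditional expectation is a relative interior point\<close>

text \<open>The action of \<open>U\<close> is linear, injective and permutes
  \<open>unitary_points B\<close>, so it maps the hull onto itself and preserves its relative
  interior.\<close>

lemma choi_conj_rel_interior:
  assumes B: "unital_cstar_subalgebra B" and U: "U \<in> unitaries B"
    and p: "p \<in> rel_interior (convex hull unitary_points B)"
  shows "choi_conj U p \<in> rel_interior (convex hull unitary_points B)"
proof -
  have UU: "unitary U" using U by (simp add: unitaries_def)
  have "choi_conj U ` unitary_points B = (\<lambda>V. choi (Ad (V ** U))) ` unitaries B"
    by (simp add: unitary_points_def image_image choi_conj_choi Ad_Ad)
  also have "\<dots> = unitary_points B" unfolding unitary_points_def
  proof (intro equalityI subsetI)
    fix x assume "x \<in> (\<lambda>V. choi (Ad V)) ` unitaries B"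
    then obtain V where V: "V \<in> unitaries B" "x = choi (Ad V)" by blast
    have "V ** cadj U ** U = V" using UU by (simp add: unitary_def flip: matrix_mul_assoc)
    then have "x = choi (Ad (V ** cadj U ** U))" using V(2) by simp
    then show "x \<in> (\<lambda>V. choi (Ad (V ** U))) ` unitaries B"
      using unitaries_mmul[OF B V(1) unitaries_cadj[OF B U]] by (rule image_eqI)
  qed (use unitaries_mmul[OF B _ U] in blast)
  finally have "choi_conj U ` (convex hull unitary_points B) = convex hull unitary_points B"
    by (simp add: convex_hull_linear_image[OF linear_choi_conj])
  moreover have "inj (choi_conj U)"
    unfolding linear_injective_0[OF linear_choi_conj]
  proof (intro allI impI)
    fix M assume "choi_conj U M = 0"
    then show "M = 0" using norm_choi_conj[OF UU, of M] by simp
  qed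
  ultimately show ?thesis
    using rel_interior_injective_linear_image[of "choi_conj U" "convex hull unitary_points B"] p
      linear_choi_conj[of U] by (simp add: linear_conv_bounded_linear) blast
qed

text \<open>A substitute for averaging over the unitary group: the hull of an orbit stays in the
  convex relative interior, and its point of least norm, being unique, is fixed by the isometries
  that preserve the hull.\<close>

lemma exists_invariant_rel_interior_point:
  assumes B: "unital_cstar_subalgebra B"
  obtains q where "q \<in> rel_interior (convex hull unitary_points B)"
    "\<And>U. U \<in> unitaries B \<Longrightarrow> choi_conj U q = q"
proof -
  define K where "K = convex hull unitary_points B"
  have "unitary_points B \<noteq> {}" using unitaries_one[OF B] by (auto simp: unitary_points_def)
  then have "rel_interior K \<noteq> {}" unfolding K_def by (simp add: rel_interior_eq_empty)
  then obtain p where p: "p \<in> rel_interior K" by blast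
  define orb where "orb = (\<lambda>U. choi_conj U p) ` unitaries B"
  have orbK: "convex hull orb \<subseteq> rel_interior K"
    unfolding orb_def using choi_conj_rel_interior[OF B] p
    by (intro hull_minimal) (auto simp: K_def intro: convex_rel_interior)
  have "compact orb" unfolding orb_def
    by (rule compact_continuous_image[OF continuous_on_choi_conj compact_unitaries[OF B]])
  then have cl: "closed (convex hull orb)" by (intro compact_imp_closed compact_convex_hull)
  have ne: "convex hull orb \<noteq> {}" using unitaries_one[OF B] by (auto simp: orb_def)
  define q where "q = closest_point (convex hull orb) 0"
  have q: "q \<in> convex hull orb" unfolding q_def by (rule closest_point_in_set[OF cl ne])
  have "choi_conj U q = q" if U: "U \<in> unitaries B" for U
  proof -
    have "choi_conj U ` orb \<subseteq> orb"
      using unitaries_mmul[OF B _ U] by (auto simp: orb_def choi_conj_choi_conj)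
    then have "choi_conj U ` (convex hull orb) \<subseteq> convex hull orb"
      by (simp add: convex_hull_linear_image[OF linear_choi_conj] hull_mono)
    then have mem: "choi_conj U q \<in> convex hull orb" using q by blast
    have "norm (choi_conj U q) = norm q" using U by (simp add: norm_choi_conj unitaries_def)
    then have "dist 0 (choi_conj U q) \<le> dist 0 z" if "z \<in> convex hull orb" for z
      using closest_point_le[OF cl that, of 0] by (simp flip: q_def)
    then have "choi_conj U q = closest_point (convex hull orb) 0"
      by (intro closest_point_unique[OF convex_convex_hull cl mem]) blast
    then show ?thesis by (simp flip: q_def)
  qed
  moreover have "q \<in> rel_interior (convex hull unitary_points B)" using q orbK unfolding K_def by blast
  ultimately show ?thesis by (intro that)
qed

lemma Ad_eq_iff_commute:
  assumes "unitary U"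
  shows "Ad U Y = Y \<longleftrightarrow> U ** Y = Y ** U"
proof
  assume "Ad U Y = Y"
  then have "U ** Y = U ** (cadj U ** Y ** U)" by (simp add: Ad_def)
  also have "\<dots> = (U ** cadj U) ** Y ** U" by (simp only: matrix_mul_assoc)
  finally show "U ** Y = Y ** U" using assms by (simp add: unitary_def)
next
  assume "U ** Y = Y ** U"
  then have "Ad U Y = (cadj U ** U) ** Y" by (simp add: Ad_def flip: matrix_mul_assoc)
  then show "Ad U Y = Y" using assms by (simp add: unitary_def)
qed

text \<open>Projections span \<open>B\<close>, and each projection \<open>P\<close> gives the
  unitary \<open>mat 1 - 2 *\<^sub>R P\<close>.\<close>

lemma commute_of_commute_unitaries:
  assumes B: "unital_cstar_subalgebra B" and Y: "\<And>U. U \<in> unitaries B \<Longrightarrow> U ** Y = Y ** U"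
    and "Z \<in> B"
  shows "Z ** Y = Y ** Z"
proof (rule clinear_eq_on_projections[OF B clinear_mmul(2) clinear_mmul(3) _ \<open>Z \<in> B\<close>])
  note cl = subalgebra_intros[OF B]
  fix P assume P: "P \<in> B" "projection P"
  define U where "U = mat 1 - 2 *\<^sub>R P"
  have h: "cadj P = P" "P ** P = P" using P by (auto simp: projection_def)
  have "cadj U = U" by (simp add: U_def cadj_diff h)
  moreover have "U ** U = mat 1" by (simp add: U_def mmul_distribs h) (simp add: vec_eq_iff scaleR_conv_of_real)
  ultimately have "U \<in> unitaries B" using P cl by (simp add: unitaries_def unitary_def U_def)
  from Y[OF this] show "P ** Y = Y ** P" by (simp add: U_def mmul_distribs)
qed

text \<open>The invariant point \<open>q\<close> is identified with \<open>E\<close> in two steps: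
  its values lie in \<open>S\<close>, where \<open>E\<close> is the identity, and \<open>E\<close>
  absorbs every map in the hull. Hence \<open>choi_map q X = E (choi_map q X) = E X\<close>.\<close>

lemma cond_expectation_rel_interior:
  assumes S: "unital_cstar_subalgebra S" and E: "E \<in> fixing_channels S" and range: "range E = S"
  shows "choi E \<in> rel_interior (convex hull unitary_points (commutant S))"
proof -
  define B where "B = commutant S"
  have B: "unital_cstar_subalgebra B" unfolding B_def by (rule commutant_subalgebra[OF S])
  have E_lin: "clinear_map E" and tp: "\<And>X. trace (E X) = trace X" and fixed: "\<And>A. A \<in> S \<Longrightarrow> E A = A"
    using E by (auto simp: fixing_channels_def unital_channel_def completely_positive_def)
  obtain V :: "'a \<times> 'a \<Rightarrow> 'a cmat" where V: "\<And>X. E X = (\<Sum>k\<in>UNIV. Ad (V k) X)" "\<And>k. V k \<in> B"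
    and norm1: "(\<Sum>k\<in>UNIV. cadj (V k) ** V k) = mat 1"
    unfolding B_def by (rule fixing_channel_kraus[OF S E]) blast
  obtain q where q: "q \<in> rel_interior (convex hull unitary_points B)"
    and inv: "\<And>U. U \<in> unitaries B \<Longrightarrow> choi_conj U q = q"
    by (rule exists_invariant_rel_interior_point[OF B]) blast
  \<comment> \<open>Invariance puts the values in the commutant of \<open>B\<close>. Since the Kraus
    operators of \<open>E\<close> lie in \<open>B\<close>, such values are fixed by
    \<open>E\<close>, hence in its range \<open>S\<close>.\<close>
  have q_in_S: "choi_map q X \<in> S" for X
  proof -
    define Y where "Y = choi_map q X"
    have "U ** Y = Y ** U" if "U \<in> unitaries B" for U
      using inv[OF that] choi_map_choi_conj[of U q X] that
      by (simp add: Y_def unitaries_def flip: Ad_eq_iff_commute)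
    then have comm: "Z ** Y = Y ** Z" if "Z \<in> B" for Z
      using commute_of_commute_unitaries[OF B _ that] by blast
    have "E Y = (\<Sum>k\<in>UNIV. cadj (V k) ** V k) ** Y"
      unfolding V(1) mmul_sum_left
    proof (intro sum.cong refl)
      fix k show "Ad (V k) Y = cadj (V k) ** V k ** Y"
        using comm[OF V(2)[of k]] by (simp add: Ad_def flip: matrix_mul_assoc)
    qed
    then have "E Y = Y" by (simp add: norm1)
    then show ?thesis using range Y_def by (metis rangeI)
  qed
  have bimod: "E (a ** X) = a ** E X" if a: "a \<in> S" for a X
  proof -
    have "Ad (V k) (a ** X) = a ** Ad (V k) X" for k
    proof -
      have "cadj (V k) ** a = a ** cadj (V k)"
        using subalgebra_closed(5)[OF B V(2)[of k]] a by (simp add: B_def commutant_def)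
      then show ?thesis by (simp add: Ad_def matrix_mul_assoc)
    qed
    then show ?thesis by (simp add: V(1) mmul_sum_right)
  qed
  \<comment> \<open>The difference \<open>W\<close> lies in \<open>S\<close>, so
    \<open>cadj W\<close> commutes with \<open>U\<close>; left \<open>S\<close>-linearity of
    \<open>E\<close> and trace preservation then show that \<open>W\<close> is orthogonal to
    itself.\<close>
  have E_Ad: "E (Ad U X) = E X" if U: "U \<in> unitaries B" for U X
  proof -
    define W where "W = E (Ad U X) - E X"
    have "W \<in> S" unfolding W_def using range subalgebra_diff[OF S] by auto
    then have a: "cadj W \<in> S" using subalgebra_closed(5)[OF S] by blast
    have comm: "cadj U ** cadj W = cadj W ** cadj U" and UU: "U ** cadj U = mat 1"
      using unitaries_cadj[OF B U] U a by (auto simp: unitaries_def unitary_def B_def commutant_def)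
    have "trace (cadj W ** E (Ad U X)) = trace (cadj W ** Ad U X)"
      using bimod[OF a] tp by metis
    also have "\<dots> = trace (cadj U ** (cadj W ** X ** U))"
      by (simp add: Ad_def matrix_mul_assoc comm)
    also have "\<dots> = trace (cadj W ** X ** (U ** cadj U))"
      by (subst trace_mul_sym) (simp only: matrix_mul_assoc)
    also have "\<dots> = trace (cadj W ** E X)"
      unfolding UU using bimod[OF a, of X] tp[of "cadj W ** X"] by simp
    finally have "trace (cadj W ** W) = 0" by (simp add: W_def mmul_distribs trace_sub)
    then have "W = 0" by (simp add: trace_cadj_mmul_self)
    then show ?thesis by (simp add: W_def)
  qed
  have "convex {M. \<forall>X. E (choi_map M X) = E X}"
  proof (rule convexI)
    fix M M' and u v :: real
    assume M: "M \<in> {M. \<forall>X. E (choi_map M X) = E X}" "M' \<in> {M. \<forall>X. E (choi_map M X) = E X}"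
      and uv: "u + v = 1"
    note l = linear_add[OF clinear_map_linear[OF E_lin]] linear_scale[OF clinear_map_linear[OF E_lin]]
    have "u *\<^sub>R Y + v *\<^sub>R Y = Y" for Y :: "'a cmat" using uv by (simp flip: scaleR_add_left)
    then show "u *\<^sub>R M + v *\<^sub>R M' \<in> {M. \<forall>X. E (choi_map M X) = E X}"
      using M by (simp add: choi_map_linear l)
  qed
  then have "convex hull unitary_points B \<subseteq> {M. \<forall>X. E (choi_map M X) = E X}"
    by (intro hull_minimal) (auto simp: unitary_points_def choi_map_choi clinear_Ad E_Ad)
  then have "E (choi_map q X) = E X" for X using q rel_interior_subset by blast
  then have "choi_map q = E" using fixed[OF q_in_S] by (metis ext)
  then have "q = choi E" using choi_choi_map by metis
  then show ?thesis using q by (simp add: B_def)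
qed

section \<open>Channels fixing the subalgebra lie in the affine hull\<close>

text \<open>Turns a real functional on Choi points into a form whose values on channels can be
  computed from Kraus operators.\<close>

lemma linear_functional_as_form:
  fixes z :: "'n::finite cmat^'n^'n"
  obtains \<beta> where "cbilinear_form \<beta>" "\<And>V. \<beta> (cadj V) V = complex_of_real (z \<bullet> choi (Ad V))"
proof -
  define \<gamma> where "\<gamma> X Y = (\<Sum>a\<in>UNIV. \<Sum>b\<in>UNIV. trace (cadj (z $ a $ b) ** (X ** unit_mat a b ** Y)))" for X Y
  \<comment> \<open>Averaging with the conjugated form keeps bilinearity and replaces the value at
    \<open>cadj V, V\<close> by its real part.\<close>
  define \<beta> where "\<beta> X Y = (\<gamma> X Y + cnj (\<gamma> (cadj Y) (cadj X))) / 2" for X Y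
  have \<gamma>: "\<gamma> (X + X') Y = \<gamma> X Y + \<gamma> X' Y" "\<gamma> X (Y + Y') = \<gamma> X Y + \<gamma> X Y'"
    "\<gamma> (csmult c X) Y = c * \<gamma> X Y" "\<gamma> X (csmult c Y) = c * \<gamma> X Y" for X X' Y Y' c
    by (simp_all add: \<gamma>_def mmul_distribs trace_add sum.distrib sum_distrib_left)
  have "cbilinear_form \<beta>" unfolding cbilinear_form_def \<beta>_def
    by (simp add: \<gamma> cadj_add field_simps)
  moreover have "\<beta> (cadj V) V = complex_of_real (z \<bullet> choi (Ad V))" for V
  proof -
    have "Re (\<gamma> (cadj V) V) = z \<bullet> choi (Ad V)"
      by (simp add: \<gamma>_def inner_vec_def[where 'b = 'n and 'a = "'n cmat^'n"] inner_vec_def[where 'a = "'n cmat"]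
          inner_cmat choi_def Ad_def)
    then show ?thesis by (simp add: \<beta>_def complex_eq_iff)
  qed
  ultimately show ?thesis by (rule that)
qed

text \<open>Let \<open>z\<close> be the part of \<open>choi F - e\<close> orthogonal to the
  directions of the affine hull. The functional of \<open>z\<close> is constant on unitary points,
  so it takes the same value at the doubly normalized Kraus sum \<open>F\<close>, and
  \<open>z\<close> is orthogonal to itself.\<close>

lemma fixing_channel_affine_hull:
  assumes S: "unital_cstar_subalgebra S" and F: "F \<in> fixing_channels S"
  shows "choi F \<in> affine hull unitary_points (commutant S)"
proof -
  define B where "B = commutant S"
  have B: "unital_cstar_subalgebra B" unfolding B_def by (rule commutant_subalgebra[OF S])
  obtain V :: "'a \<times> 'a \<Rightarrow> 'a cmat" where V: "\<And>X. F X = (\<Sum>k\<in>UNIV. Ad (V k) X)" "\<And>k. V k \<in> B"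
    and norm: "(\<Sum>k\<in>UNIV. cadj (V k) ** V k) = mat 1" "(\<Sum>k\<in>UNIV. V k ** cadj (V k)) = mat 1"
    unfolding B_def by (rule fixing_channel_kraus[OF S F]) blast
  define e :: "'a cmat^'a^'a" where "e = choi (Ad (mat 1))"
  have e: "e \<in> unitary_points B" unfolding e_def unitary_points_def using unitaries_one[OF B] by blast
  define D where "D = (\<lambda>x. - e + x) ` (unitary_points B - {e})"
  have hull: "affine hull unitary_points B = (\<lambda>x. e + x) ` span D"
    unfolding D_def by (rule affine_hull_span2[OF e])
  obtain y z where yz: "y \<in> span D" "\<And>w. w \<in> span D \<Longrightarrow> orthogonal z w" "choi F - e = y + z"
    using orthogonal_subspace_decomp_exists[of D "choi F - e"] by blast
  obtain \<beta> where \<beta>: "cbilinear_form \<beta>" "\<And>V. \<beta> (cadj V) V = complex_of_real (z \<bullet> choi (Ad V))"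
    by (rule linear_functional_as_form[of z]) blast
  have const: "\<beta> (cadj U) U = complex_of_real (z \<bullet> e)" if U: "U \<in> B" "unitary U" for U
  proof -
    have "choi (Ad U) - e \<in> span D"
    proof (cases "choi (Ad U) = e")
      case False
      then show ?thesis using U unfolding D_def unitary_points_def unitaries_def
        by (intro span_base) (auto intro!: image_eqI[where x = "choi (Ad U)"])
    qed (simp add: span_zero)
    from yz(2)[OF this] show ?thesis by (simp add: \<beta>(2) orthogonal_def inner_diff_right)
  qed
  have "choi F = (\<Sum>k\<in>UNIV. choi (Ad (V k)))" by (simp add: choi_def vec_eq_iff V(1))
  then have "complex_of_real (z \<bullet> choi F) = (\<Sum>k\<in>UNIV. \<beta> (cadj (V k)) (V k))"
    by (simp add: \<beta>(2) inner_sum_right)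
  also have "\<dots> = complex_of_real (z \<bullet> e)"
    by (rule form_sum_doubly_normalized[OF B \<beta>(1) const V(2) norm])
  finally have "z \<bullet> (choi F - e) = 0" by (simp add: inner_diff_right)
  moreover have "z \<bullet> y = 0" using yz(1,2) by (simp add: orthogonal_def)
  ultimately have "z = 0" by (simp add: yz(3) inner_add_right)
  then have "choi F = e + y" using yz(3) by (simp add: algebra_simps)
  then show ?thesis using yz(1) hull by (auto simp: B_def)
qed

lemma convex_hull_mixed_unitary:
  assumes F: "clinear_map F" and mem: "choi F \<in> convex hull unitary_points B"
  shows "mixed_unitary F"
proof -
  obtain l :: nat and u x where ux: "\<And>i. i \<in> {1..l} \<Longrightarrow> 0 \<le> u i \<and> x i \<in> unitary_points B"
    and u1: "sum u {1..l} = 1" and sum: "(\<Sum>i = 1..l. u i *\<^sub>R x i) = choi F"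
    using mem unfolding convex_hull_indexed by blast
  have "\<exists>U. i \<in> {1..l} \<longrightarrow> unitary U \<and> x i = choi (Ad U)" for i
    using ux[of i] by (auto simp: unitary_points_def unitaries_def)
  then obtain U where U: "\<And>i. i \<in> {1..l} \<Longrightarrow> unitary (U i) \<and> x i = choi (Ad (U i))" by metis
  \<comment> \<open>The hull representation is indexed from 1 and \<open>mixed_unitary\<close> from
    0, hence the shift by \<open>Suc\<close>.\<close>
  have "F X = (\<Sum>j<l. csmult (complex_of_real (u (Suc j))) (Ad (U (Suc j)) X))" for X
  proof -
    have "F X = choi_map (choi F) X" by (simp add: choi_map_choi[OF F])
    also have "\<dots> = (\<Sum>i = 1..l. u i *\<^sub>R choi_map (x i) X)" by (simp add: choi_map_sum flip: sum)
    also have "\<dots> = (\<Sum>i = 1..l. csmult (complex_of_real (u i)) (Ad (U i) X))"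
      using U by (intro sum.cong) (auto simp: choi_map_choi clinear_Ad csmult_of_real)
    finally show ?thesis by (simp add: sum.atLeast1_atMost_eq)
  qed
  moreover have "(\<Sum>j<l. u (Suc j)) = 1" using u1 by (simp add: sum.atLeast1_atMost_eq)
  moreover have "u (Suc j) \<ge> 0 \<and> unitary (U (Suc j))" if "j < l" for j
    using ux[of "Suc j"] U[of "Suc j"] that by auto
  ultimately show ?thesis unfolding mixed_unitary_def
    by (intro exI[of _ l] exI[of _ "\<lambda>j. u (Suc j)"] exI[of _ "\<lambda>j. U (Suc j)"]) auto
qed

theorem theorem3p4:
  fixes S :: "'n::finite cmat set"
    and E :: "'n cmat \<Rightarrow> 'n cmat"
    and N :: "('n cmat \<Rightarrow> 'n cmat) \<Rightarrow> real"
  assumes "unital_cstar_subalgebra S"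
    and "cond_expectation S E"
    and "\<forall>X. trace (E X) = trace X"
    and "is_map_norm N"
  shows "\<exists>r>0. \<forall>\<Phi>\<in>fixing_channels S. N (\<lambda>X. \<Phi> X - E X) \<le> r \<longrightarrow> mixed_unitary \<Phi>"
proof -
  have range: "range E = S" and E: "E \<in> fixing_channels S"
    using assms(1-3) by (auto simp: cond_expectation_def fixing_channels_def unital_channel_def
        subalgebra_closed)
  define K where "K = convex hull unitary_points (commutant S)"
  \<comment> \<open>Within the affine hull of \<open>K\<close>, a Euclidean ball of radius
    \<open>e\<close> around \<open>choi E\<close> stays in \<open>K\<close>; the constant
    \<open>m\<close> below converts \<open>e\<close> into the radius \<open>m * e\<close> for
    \<open>N\<close>.\<close>
  obtain e where e: "e > 0" "cball (choi E) e \<inter> affine hull K \<subseteq> K"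
    using cond_expectation_rel_interior[OF assms(1) E range]
    unfolding K_def mem_rel_interior_cball by blast
  obtain m where m: "m > 0" "\<And>F. clinear_map F \<Longrightarrow> m * norm (choi F) \<le> N F"
    using map_norm_dominates[OF assms(4)] by blast
  have lin: "clinear_map F" if "F \<in> fixing_channels S" for F
    using that by (simp add: fixing_channels_def unital_channel_def completely_positive_def)
  have "mixed_unitary \<Phi>" if \<Phi>: "\<Phi> \<in> fixing_channels S" and near: "N (\<lambda>X. \<Phi> X - E X) \<le> m * e" for \<Phi>
  proof -
    have "clinear_map (\<lambda>X. \<Phi> X - E X)"
      using lin[OF \<Phi>] lin[OF E] by (simp add: clinear_map_def csmult_diff)
    moreover have "choi (\<lambda>X. \<Phi> X - E X) = choi \<Phi> - choi E" by (simp add: choi_def vec_eq_iff)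
    ultimately have "m * norm (choi \<Phi> - choi E) \<le> m * e" using m(2) near by fastforce
    then have "choi \<Phi> \<in> cball (choi E) e" using m(1) by (simp add: dist_norm norm_minus_commute)
    moreover have "choi \<Phi> \<in> affine hull K"
      unfolding K_def using fixing_channel_affine_hull[OF assms(1) \<Phi>] by simp
    ultimately have "choi \<Phi> \<in> K" using e(2) by blast
    then show ?thesis unfolding K_def by (rule convex_hull_mixed_unitary[OF lin[OF \<Phi>]])
  qed
  then show ?thesis using m(1) e(1) by (intro exI[of _ "m * e"]) simp
qed

end
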